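(* If $\Delta$ is a simple polytope that contains no pervasive facets and no flat facets, then every mass linear function on $\Delta$ is constant.
   Context: Let $\mathfrak t$ be a finite-dimensional real vector space with dual $\mathfrak t^*$ and pairing $\langle\cdot,\cdot\rangle$; polytopes live in an affine space modeled on $\mathfrak t^*$, which we identify with $\mathfrak t^*$. A polytope is a bounded set $\Delta=\bigcap_{i=1}^N\{x\in\mathfrak t^*\mid\langle\eta_i,x\rangle\le\kappa_i\}$ with outward conormals $\eta_i\in\mathfrak t$ and support numbers $\kappa_i\in\mathbb R$, where $\Delta$ affinely spans $\mathfrak t^*$ and each facet $F_i=\Delta\cap\{\langle\eta_i,x\rangle=\kappa_i\}$ affinely spans a hyperplane. It is simple if exactly $\dim\mathfrak t$ facets meet at each vertex. For $\kappa'\in\mathbb R^N$ let $\Delta(\kappa')=\bigcap_i\{\langle\eta_i,x\rangle\le\kappa'_i\}$. The chamber $\mathcal C_\Delta\subset\mathbb R^N$ is the connected component containing $\kappa$ of the set of $\kappa'$ for which $\Delta(\kappa')$ is a simple polytope (with $N$ facets, that is, $\Delta(\kappa')$ affinely spans $\mathfrak t^*$, each of the $N$ sets $\Delta(\kappa')\cap\{\langle\eta_i,x\rangle=\kappa'_i\}$ affinely spans a hyperplane, and exactly $\dim\mathfrak t$ of these $N$ facets meet at each vertex). Let $c_\Delta(\kappa')$ be the center of mass of $\Delta(\kappa')$. An affine function $H:\mathfrak t^*\to\mathbb R$ is mass linear on $\Delta$ if there are constants $\gamma_i,C\in\mathbb R$ with $H(c_\Delta(\kappa'))=\sum_i\gamma_i\kappa'_i+C$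 for all $\kappa'\in\mathcal C_\Delta$. A facet $F$ is pervasive if it has nonempty intersection with every other facet of $\Delta$. A facet $F$ is flat if there is a hyperplane (linear, of codimension one) in $\mathfrak t$ containing the conormal of every facet, other than $F$ itself, that meets $F$. *)

theory Defs
  imports "HOL-Analysis.Analysis"
begin

text \<open>
  The type \<open>'a\<close> plays the role of both the vector space \<open>t\<close> and its dual; the pairing is the
  inner product. The index set of the facets is the finite type \<open>'n\<close>, so \<open>N = CARD('n)\<close> and
  support vectors have type \<open>real ^ 'n\<close>.
\<close>

definition halfspace_Int :: "('n::finite \<Rightarrow> 'a::euclidean_space) \<Rightarrow> real ^ 'n \<Rightarrow> 'a set" where
  "halfspace_Int \<eta> \<kappa> = (\<Inter>i. {x. \<eta> i \<bullet> x \<le> \<kappa> $ i})"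

definition facet :: "('n::finite \<Rightarrow> 'a::euclidean_space) \<Rightarrow> real ^ 'n \<Rightarrow> 'n \<Rightarrow> 'a set" where
  "facet \<eta> \<kappa> i = halfspace_Int \<eta> \<kappa> \<inter> {x. \<eta> i \<bullet> x = \<kappa> $ i}"

definition spans_hyperplane :: "'a::euclidean_space set \<Rightarrow> bool" where
  "spans_hyperplane F \<longleftrightarrow> (\<exists>a b. a \<noteq> 0 \<and> affine hull F = {x. a \<bullet> x = b})"

definition is_polytope :: "('n::finite \<Rightarrow> 'a::euclidean_space) \<Rightarrow> real ^ 'n \<Rightarrow> bool" where
  "is_polytope \<eta> \<kappa> \<longleftrightarrow>
     bounded (halfspace_Int \<eta> \<kappa>) \<and>
     affine hull (halfspace_Int \<eta> \<kappa>) = UNIV \<and>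
     (\<forall>i. spans_hyperplane (facet \<eta> \<kappa> i))"

text \<open>
  Facets through a vertex are counted by index. This also makes the \<open>N\<close> facets pairwise distinct:
  if \<open>F\<^sub>i = F\<^sub>j\<close> with \<open>i \<noteq> j\<close>, then at a vertex of \<open>F\<^sub>i\<close> the conormals span the whole space, but
  two of them are parallel, so more than \<open>DIM('a)\<close> indices are active there.
\<close>

definition simple_polytope :: "('n::finite \<Rightarrow> 'a::euclidean_space) \<Rightarrow> real ^ 'n \<Rightarrow> bool" where
  "simple_polytope \<eta> \<kappa> \<longleftrightarrow>
     is_polytope \<eta> \<kappa> \<and>
     (\<forall>v. v extreme_point_of (halfspace_Int \<eta> \<kappa>) \<longrightarrow> card {i. v \<in> facet \<eta> \<kappa> i} = DIM('a))"

definition chamber :: "('n::finite \<Rightarrow> 'a::euclidean_space) \<Rightarrow> real ^ 'n \<Rightarrow> (real ^ 'n) set" where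
  "chamber \<eta> \<kappa> = connected_component_set {\<kappa>'. simple_polytope \<eta> \<kappa>'} \<kappa>"

text \<open>
  The center of mass does not depend on the choice of inner product, since that only rescales
  Lebesgue measure.
\<close>

definition center_of_mass :: "'a::euclidean_space set \<Rightarrow> 'a" where
  "center_of_mass S = (LINT x:S|lborel. x) /\<^sub>R measure lborel S"

definition affine_function :: "('a::real_vector \<Rightarrow> real) \<Rightarrow> bool" where
  "affine_function H \<longleftrightarrow> (\<exists>f c. linear f \<and> (\<forall>x. H x = f x + c))"

definition mass_linear ::
  "('n::finite \<Rightarrow> 'a::euclidean_space) \<Rightarrow> real ^ 'n \<Rightarrow> ('a \<Rightarrow> real) \<Rightarrow> bool" where
  "mass_linear \<eta> \<kappa> H \<longleftrightarrow>
     affine_function H \<and>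
     (\<exists>\<gamma> C. \<forall>\<kappa>' \<in> chamber \<eta> \<kappa>.
        H (center_of_mass (halfspace_Int \<eta> \<kappa>')) = (\<Sum>i\<in>UNIV. \<gamma> i * \<kappa>' $ i) + C)"

definition pervasive_facet :: "('n::finite \<Rightarrow> 'a::euclidean_space) \<Rightarrow> real ^ 'n \<Rightarrow> 'n \<Rightarrow> bool" where
  "pervasive_facet \<eta> \<kappa> i \<longleftrightarrow> (\<forall>j. j \<noteq> i \<longrightarrow> facet \<eta> \<kappa> i \<inter> facet \<eta> \<kappa> j \<noteq> {})"

definition flat_facet :: "('n::finite \<Rightarrow> 'a::euclidean_space) \<Rightarrow> real ^ 'n \<Rightarrow> 'n \<Rightarrow> bool" where
  "flat_facet \<eta> \<kappa> i \<longleftrightarrow>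
     (\<exists>V. subspace V \<and> dim V + 1 = DIM('a) \<and>
          (\<forall>j. j \<noteq> i \<and> facet \<eta> \<kappa> i \<inter> facet \<eta> \<kappa> j \<noteq> {} \<longrightarrow> \<eta> j \<in> V))"

end

theory Submission
  imports Defs
begin

text \<open>
  Let \<open>H\<close> be mass linear with coefficients \<open>\<gamma>\<close>. If all coefficients vanish, then \<open>H\<close> takes the same
  value at the centers of mass of all small translates of the polytope, so its linear part is zero.
  Suppose \<open>\<gamma> i \<noteq> 0\<close>. As the \<open>i\<close>-th facet is not pervasive, some facet \<open>j\<close> is disjoint from it. For
  disjoint facets the mixed second derivatives of the volume \<open>V\<close> and of the integral of \<open>H\<close> vanish. The
  latter equals \<open>L * V\<close> with \<open>L\<close> affine with coefficients \<open>\<gamma>\<close>, so that \<open>\<gamma> i * V\<^sub>j + \<gamma> j * V\<^sub>i = 0\<close>, where \<open>V\<^sub>j\<close>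
  is the derivative of \<open>V\<close> in the \<open>j\<close>-th support number. Since \<open>V\<^sub>i\<close> does not change when the facet
  \<open>j\<close> moves, neither does \<open>V\<^sub>j\<close>: the volume is affine in the \<open>j\<close>-th support number, throughout a
  neighbourhood in the chamber (\<open>volume_affine_if_mass_linear\<close>). This forces the facet \<open>j\<close> to be flat
  (\<open>flat_facet_if_volume_affine\<close>), a contradiction.

  For the last step, differentiate \<open>V\<^sub>j\<close> further in the directions of the other facets that
  contain a given edge of the facet \<open>j\<close>. The result is a multiple of the length of the edge, which thus
  does not change either when the facet \<open>j\<close> moves. Hence the direction that is dual to \<open>\<eta> j\<close> with respect to
  the conormals at one end of the edge is also the dual direction at the other end
  (\<open>volume_affine_edge\<close>). All vertices of the facet therefore share this direction, and its orthogonal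
  complement contains the conormals of all other facets that meet the facet \<open>j\<close>.

  All derivatives are replaced by finite differences with small steps. Iterated differences of
  the volume are volumes of explicit regions, so neither differentiability of the volume nor Fubini's
  theorem is needed; volumes are only compared through inclusions and translations.
\<close>

section \<open>Vectors with prescribed pairings\<close>

lemma independent_family_dual:
  fixes \<eta> :: "'n \<Rightarrow> 'a::euclidean_space"
  assumes "inj_on \<eta> B" "independent (\<eta> ` B)"
  obtains z where "\<And>l. l \<in> B \<Longrightarrow> \<eta> l \<bullet> z = g l"
proof -
  obtain f :: "'a \<Rightarrow> real" where f: "linear f" "\<And>y. y \<in> \<eta> ` B \<Longrightarrow> f y = g (the_inv_into B \<eta> y)"
    using linear_independent_extend [OF assms(2), of "\<lambda>y. g (the_inv_into B \<eta> y)"] by blast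
  have "\<eta> l \<bullet> (\<Sum>b\<in>Basis. f b *\<^sub>R b) = g l" if "l \<in> B" for l
  proof -
    have "\<eta> l \<bullet> (\<Sum>b\<in>Basis. f b *\<^sub>R b) = f (\<Sum>b\<in>Basis. (\<eta> l \<bullet> b) *\<^sub>R b)"
      by (simp add: linear_sum [OF f(1)] linear_cmul [OF f(1)] inner_sum_right mult.commute)
    also have "\<dots> = g l"
      using that assms(1) by (simp add: euclidean_representation f(2) the_inv_into_f_f)
    finally show ?thesis .
  qed
  then show thesis by (rule that)
qed

lemma spanning_family_eqI:
  assumes "span (\<eta> ` B) = UNIV" "\<And>l. l \<in> B \<Longrightarrow> \<eta> l \<bullet> x = \<eta> l \<bullet> y"
  shows "x = y"
proof -
  have "orthogonal (x - y) (x - y)"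
    by (rule orthogonal_to_span [of _ "\<eta> ` B"])
      (use assms in \<open>auto simp: orthogonal_def inner_diff_left inner_diff_right inner_commute\<close>)
  then show ?thesis by (simp add: orthogonal_def)
qed

text \<open>Finitely many smallness conditions on a positive factor can be met at once.\<close>

lemma small_multiple:
  fixes c d :: "'m \<Rightarrow> real"
  assumes "finite M" "\<And>m. m \<in> M \<Longrightarrow> 0 < d m"
  obtains e where "0 < e" "\<And>m. m \<in> M \<Longrightarrow> e * c m < d m"
proof -
  have "\<forall>\<^sub>F e in at_right 0. e * c m < d m" if "m \<in> M" for m
  proof (rule order_tendstoD(2))
    show "((\<lambda>e. e * c m) \<longlongrightarrow> 0) (at_right 0)" by (auto intro!: tendsto_eq_intros)
  qed (use assms(2) that in auto)
  then have "\<forall>\<^sub>F e in at_right 0. \<forall>m\<in>M. e * c m < d m"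
    using assms(1) by (simp add: eventually_ball_finite)
  moreover have "\<forall>\<^sub>F e in at_right (0::real). 0 < e"
    by (rule eventually_at_right_less)
  ultimately have "\<forall>\<^sub>F e in at_right 0. 0 < e \<and> (\<forall>m\<in>M. e * c m < d m)"
    by eventually_elim auto
  then show thesis
    using that eventually_happens' [OF trivial_limit_at_right_real] by blast
qed

section \<open>Polyhedra with given conormals\<close>

lemma mem_halfspace_Int: "x \<in> halfspace_Int \<eta> \<kappa> \<longleftrightarrow> (\<forall>k. \<eta> k \<bullet> x \<le> \<kappa> $ k)"
  by (simp add: halfspace_Int_def)

lemma closed_halfspace_Int: "closed (halfspace_Int \<eta> \<kappa>)"
  unfolding halfspace_Int_def by (intro closed_INT ballI closed_halfspace_le)

lemma convex_halfspace_Int: "convex (halfspace_Int \<eta> \<kappa>)"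
  unfolding halfspace_Int_def by (intro convex_INT convex_halfspace_le)

lemma polyhedron_halfspace_Int: "polyhedron (halfspace_Int \<eta> \<kappa>)"
  unfolding halfspace_Int_def by (intro polyhedron_Inter) (auto simp: polyhedron_halfspace_le)

text \<open>The indices of the inequalities that are equalities at a point.\<close>

definition active :: "('n::finite \<Rightarrow> 'a::euclidean_space) \<Rightarrow> real ^ 'n \<Rightarrow> 'a \<Rightarrow> 'n set" where
  "active \<eta> \<kappa> x = {k. \<eta> k \<bullet> x = \<kappa> $ k}"

lemma active_facets: "x \<in> halfspace_Int \<eta> \<kappa> \<Longrightarrow> {k. x \<in> facet \<eta> \<kappa> k} = active \<eta> \<kappa> x"
  by (auto simp: facet_def active_def)

lemma inner_less_if_inactive:
  "x \<in> halfspace_Int \<eta> \<kappa> \<Longrightarrow> k \<notin> active \<eta> \<kappa> x \<Longrightarrow> \<eta> k \<bullet> x < \<kappa> $ k"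
  by (auto simp: mem_halfspace_Int active_def less_le)

text \<open>The points at which at least a given set of inequalities are equalities form a face: on the
  polyhedron, the sum of these inequalities is an equality exactly when each of them is.\<close>

lemma sum_active_bound:
  assumes "x \<in> halfspace_Int \<eta> \<kappa>"
  shows "(\<Sum>k\<in>A. \<eta> k) \<bullet> x \<le> (\<Sum>k\<in>A. \<kappa> $ k)"
    and "(\<Sum>k\<in>A. \<eta> k) \<bullet> x = (\<Sum>k\<in>A. \<kappa> $ k) \<longleftrightarrow> A \<subseteq> active \<eta> \<kappa> x"
proof -
  have le: "\<eta> k \<bullet> x \<le> \<kappa> $ k" for k using assms by (simp add: mem_halfspace_Int)
  then show "(\<Sum>k\<in>A. \<eta> k) \<bullet> x \<le> (\<Sum>k\<in>A. \<kappa> $ k)"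
    by (simp add: inner_sum_left sum_mono)
  have "(\<Sum>k\<in>A. \<kappa> $ k - \<eta> k \<bullet> x) = 0 \<longleftrightarrow> (\<forall>k\<in>A. \<kappa> $ k - \<eta> k \<bullet> x = 0)"
    by (rule sum_nonneg_eq_0_iff) (use le in auto)
  then show "(\<Sum>k\<in>A. \<eta> k) \<bullet> x = (\<Sum>k\<in>A. \<kappa> $ k) \<longleftrightarrow> A \<subseteq> active \<eta> \<kappa> x"
    by (auto simp: inner_sum_left sum_subtractf active_def)
qed

lemma active_subset_active_vertex:
  assumes "bounded (halfspace_Int \<eta> \<kappa>)" and y: "y \<in> halfspace_Int \<eta> \<kappa>"
  obtains v where "v extreme_point_of halfspace_Int \<eta> \<kappa>" "active \<eta> \<kappa> y \<subseteq> active \<eta> \<kappa> v"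
proof -
  let ?A = "active \<eta> \<kappa> y"
  let ?F = "halfspace_Int \<eta> \<kappa> \<inter> {x. (\<Sum>k\<in>?A. \<eta> k) \<bullet> x = (\<Sum>k\<in>?A. \<kappa> $ k)}"
  have face: "?F face_of halfspace_Int \<eta> \<kappa>"
    by (intro face_of_Int_supporting_hyperplane_le convex_halfspace_Int sum_active_bound(1))
  have "compact ?F"
    using assms(1) by (simp add: compact_eq_bounded_closed closed_halfspace_Int bounded_Int
        closed_Int closed_hyperplane)
  moreover have "convex ?F"
    using face face_of_imp_convex by blast
  moreover have "y \<in> ?F"
    using y sum_active_bound(2) by blast
  ultimately obtain v where "v extreme_point_of ?F"
    using extreme_point_exists_convex by blast
  then have "v extreme_point_of halfspace_Int \<eta> \<kappa>" "v \<in> ?F"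
    using extreme_point_of_face [OF face] by auto
  then show thesis
    using that sum_active_bound(2) [of v \<eta> \<kappa> ?A] by auto
qed

text \<open>Vertices are the points at which the active conormals span. If they do not, the point can be
  moved a little in both directions orthogonal to them.\<close>

lemma extreme_point_iff_span_active:
  assumes x: "x \<in> halfspace_Int \<eta> \<kappa>"
  shows "x extreme_point_of halfspace_Int \<eta> \<kappa> \<longleftrightarrow> span (\<eta> ` active \<eta> \<kappa> x) = UNIV"
proof
  assume ext: "x extreme_point_of halfspace_Int \<eta> \<kappa>"
  show "span (\<eta> ` active \<eta> \<kappa> x) = UNIV"
  proof (rule ccontr)
    assume "span (\<eta> ` active \<eta> \<kappa> x) \<noteq> UNIV"
    then have "dim (\<eta> ` active \<eta> \<kappa> x) < DIM('a)"
      by (metis dim_eq_full dim_subset_UNIV le_neq_implies_less)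
    then obtain u where u: "u \<noteq> 0" "\<And>y. y \<in> span (\<eta> ` active \<eta> \<kappa> x) \<Longrightarrow> orthogonal u y"
      using orthogonal_to_subspace_exists by metis
    have u0: "\<eta> k \<bullet> u = 0" if "k \<in> active \<eta> \<kappa> x" for k
      using u(2) [of "\<eta> k"] that by (simp add: span_base orthogonal_def inner_commute)
    obtain e where e: "0 < e" "\<And>k. k \<in> - active \<eta> \<kappa> x \<Longrightarrow> e * \<bar>\<eta> k \<bullet> u\<bar> < \<kappa> $ k - \<eta> k \<bullet> x"
      using small_multiple [of "- active \<eta> \<kappa> x" "\<lambda>k. \<kappa> $ k - \<eta> k \<bullet> x" "\<lambda>k. \<bar>\<eta> k \<bullet> u\<bar>"]
        inner_less_if_inactive [OF x] by auto
    have mem: "x + s *\<^sub>R u \<in> halfspace_Int \<eta> \<kappa>" if s: "\<bar>s\<bar> = e" for s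
      unfolding mem_halfspace_Int
    proof
      fix k
      show "\<eta> k \<bullet> (x + s *\<^sub>R u) \<le> \<kappa> $ k"
      proof (cases "k \<in> active \<eta> \<kappa> x")
        case True
        then show ?thesis using u0 by (simp add: inner_right_distrib active_def)
      next
        case False
        have "s * (\<eta> k \<bullet> u) \<le> e * \<bar>\<eta> k \<bullet> u\<bar>"
          using s by (metis abs_ge_self abs_mult)
        then show ?thesis using e(2) [of k] False by (simp add: inner_right_distrib)
      qed
    qed
    have "x + e *\<^sub>R u \<noteq> x + (- e) *\<^sub>R u"
      using u(1) e(1) by (simp add: eq_neg_iff_add_eq_0 flip: scaleR_add_left)
    moreover have "x = (1 - 1 / 2) *\<^sub>R (x + e *\<^sub>R u) + (1 / 2) *\<^sub>R (x + (- e) *\<^sub>R u)"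
      by (simp add: algebra_simps flip: scaleR_add_left)
    ultimately have "x \<in> open_segment (x + e *\<^sub>R u) (x + (- e) *\<^sub>R u)"
      unfolding in_segment by (intro conjI exI [of _ "1 / 2"]) auto
    then show False
      using ext mem [of e] mem [of "- e"] e(1) unfolding extreme_point_of_def by auto
  qed
next
  assume span: "span (\<eta> ` active \<eta> \<kappa> x) = UNIV"
  show "x extreme_point_of halfspace_Int \<eta> \<kappa>"
  proof (rule extreme_point_of_Int_supporting_hyperplane_le)
    let ?A = "active \<eta> \<kappa> x"
    have "y = x" if "y \<in> halfspace_Int \<eta> \<kappa>" "(\<Sum>k\<in>?A. \<eta> k) \<bullet> y = (\<Sum>k\<in>?A. \<kappa> $ k)" for y
    proof (rule spanning_family_eqI [OF span])
      show "\<eta> l \<bullet> y = \<eta> l \<bullet> x" if "l \<in> ?A" for l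
        using sum_active_bound(2) [OF \<open>y \<in> halfspace_Int \<eta> \<kappa>\<close>, of ?A] that
          \<open>(\<Sum>k\<in>?A. \<eta> k) \<bullet> y = (\<Sum>k\<in>?A. \<kappa> $ k)\<close> by (auto simp: active_def)
    qed
    then show "halfspace_Int \<eta> \<kappa> \<inter> {y. (\<Sum>k\<in>?A. \<eta> k) \<bullet> y = (\<Sum>k\<in>?A. \<kappa> $ k)} = {x}"
      using x sum_active_bound(2) [OF x, of ?A] by auto
  qed (rule sum_active_bound(1))
qed

text \<open>Scaling towards a strictly feasible point shows that boundedness does not depend on the
  support numbers.\<close>

lemma bounded_halfspace_Int_change:
  fixes \<eta> :: "'n::finite \<Rightarrow> 'a::euclidean_space"
  assumes bdd: "bounded (halfspace_Int \<eta> \<kappa>)" and p: "\<And>k. \<eta> k \<bullet> p < \<kappa> $ k"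
  shows "bounded (halfspace_Int \<eta> \<kappa>')"
proof -
  obtain r where r: "0 < r" "\<And>k. r * (\<kappa>' $ k - \<eta> k \<bullet> p) < \<kappa> $ k - \<eta> k \<bullet> p"
    using small_multiple [of UNIV "\<lambda>k. \<kappa> $ k - \<eta> k \<bullet> p" "\<lambda>k. \<kappa>' $ k - \<eta> k \<bullet> p"] p by auto
  have "halfspace_Int \<eta> \<kappa>' \<subseteq> (\<lambda>y. p + (1 / r) *\<^sub>R (y - p)) ` halfspace_Int \<eta> \<kappa>"
  proof
    fix x assume x: "x \<in> halfspace_Int \<eta> \<kappa>'"
    have "\<eta> k \<bullet> (p + r *\<^sub>R (x - p)) \<le> \<kappa> $ k" for k
    proof -
      have "r * (\<eta> k \<bullet> x - \<eta> k \<bullet> p) \<le> r * (\<kappa>' $ k - \<eta> k \<bullet> p)"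
        using x r(1) by (intro mult_left_mono) (auto simp: mem_halfspace_Int)
      with r(2) [of k] show ?thesis by (simp add: inner_right_distrib inner_diff_right)
    qed
    then have "p + r *\<^sub>R (x - p) \<in> halfspace_Int \<eta> \<kappa>" by (simp add: mem_halfspace_Int)
    moreover have "x = p + (1 / r) *\<^sub>R ((p + r *\<^sub>R (x - p)) - p)" using r(1) by simp
    ultimately show "x \<in> (\<lambda>y. p + (1 / r) *\<^sub>R (y - p)) ` halfspace_Int \<eta> \<kappa>" by (rule rev_image_eqI)
  qed
  moreover have "bounded ((\<lambda>y. p + (1 / r) *\<^sub>R (y - p)) ` halfspace_Int \<eta> \<kappa>)"
  proof -
    have "(\<lambda>y. p + (1 / r) *\<^sub>R (y - p)) ` halfspace_Int \<eta> \<kappa>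
        = (\<lambda>y. (p - (1 / r) *\<^sub>R p) + y) ` (\<lambda>y. (1 / r) *\<^sub>R y) ` halfspace_Int \<eta> \<kappa>"
      by (simp add: image_image algebra_simps)
    then show ?thesis using bdd bounded_translation bounded_scaling by metis
  qed
  ultimately show ?thesis by (rule bounded_subset [rotated])
qed

text \<open>If a point nearly satisfies all inequalities, then those that are nearly equalities at it are
  equalities at a common point of the polytope. This compactness statement replaces every appeal to
  the combinatorial type of the polytope being locally constant: it yields the stability of
  simplicity and of disjointness of facets, and confines the slivers below to a neighbourhood of an
  edge.\<close>

lemma near_active_subset_active:
  fixes \<eta> :: "'n::finite \<Rightarrow> 'a::euclidean_space"
  assumes bdd: "\<And>\<kappa>'. bounded (halfspace_Int \<eta> \<kappa>')"
  obtains \<epsilon> where "0 < \<epsilon>"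
    "\<And>x. (\<And>k. \<eta> k \<bullet> x \<le> \<kappa> $ k + \<epsilon>) \<Longrightarrow>
      \<exists>y\<in>halfspace_Int \<eta> \<kappa>. {k. \<kappa> $ k - \<epsilon> \<le> \<eta> k \<bullet> x} \<subseteq> active \<eta> \<kappa> y"
proof -
  define G where
    "G A e = {x. \<forall>k. \<eta> k \<bullet> x \<le> \<kappa> $ k + e \<and> (k \<in> A \<longrightarrow> \<kappa> $ k - e \<le> \<eta> k \<bullet> x)}" for A and e :: real
  have G_mono: "G A e \<subseteq> G A e'" if "e \<le> e'" for A e e'
  proof
    fix x assume x: "x \<in> G A e"
    have "\<eta> k \<bullet> x \<le> \<kappa> $ k + e' \<and> (k \<in> A \<longrightarrow> \<kappa> $ k - e' \<le> \<eta> k \<bullet> x)" for k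
      using x that unfolding G_def by (smt (verit) mem_Collect_eq)
    then show "x \<in> G A e'" by (simp add: G_def)
  qed
  have "\<exists>e>0. G A e = {}" if A: "\<And>y. y \<in> halfspace_Int \<eta> \<kappa> \<Longrightarrow> \<not> A \<subseteq> active \<eta> \<kappa> y" for A
  proof (rule ccontr)
    assume "\<not> ?thesis"
    then have ne: "G A (inverse (real (Suc n))) \<noteq> {}" for n by auto
    have compact: "compact (G A e)" for e
    proof -
      have "G A e = halfspace_Int \<eta> (\<chi> k. \<kappa> $ k + e) \<inter> (\<Inter>k\<in>A. {x. \<eta> k \<bullet> x \<ge> \<kappa> $ k - e})"
        by (auto simp: G_def mem_halfspace_Int)
      moreover have "closed (\<Inter>k\<in>A. {x. \<eta> k \<bullet> x \<ge> \<kappa> $ k - e})"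
        by (intro closed_INT ballI closed_halfspace_ge)
      ultimately show ?thesis
        using bdd by (simp add: compact_eq_bounded_closed closed_halfspace_Int bounded_Int closed_Int)
    qed
    have "\<Inter>(range (\<lambda>n. G A (inverse (real (Suc n))))) \<noteq> {}"
      by (rule compact_nest) (use compact ne in \<open>auto intro!: G_mono simp: le_imp_inverse_le\<close>)
    then obtain y where y: "\<And>n. y \<in> G A (inverse (real (Suc n)))" by auto
    have le: "\<eta> k \<bullet> y \<le> \<kappa> $ k" for k
    proof (rule field_le_epsilon)
      fix e :: real assume "0 < e"
      then obtain n where "inverse (real (Suc n)) < e" using reals_Archimedean by blast
      then show "\<eta> k \<bullet> y \<le> \<kappa> $ k + e" using y [of n] unfolding G_def by (smt (verit) mem_Collect_eq)
    qed
    have ge: "\<kappa> $ k \<le> \<eta> k \<bullet> y" if "k \<in> A" for k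
    proof (rule field_le_epsilon)
      fix e :: real assume "0 < e"
      then obtain n where "inverse (real (Suc n)) < e" using reals_Archimedean by blast
      then show "\<kappa> $ k \<le> \<eta> k \<bullet> y + e"
        using y [of n] that unfolding G_def by (smt (verit) mem_Collect_eq)
    qed
    show False
      using A [of y] le ge by (auto simp: mem_halfspace_Int active_def intro: antisym)
  qed
  then obtain e where e: "\<And>A. (\<And>y. y \<in> halfspace_Int \<eta> \<kappa> \<Longrightarrow> \<not> A \<subseteq> active \<eta> \<kappa> y) \<Longrightarrow>
      0 < e A \<and> G A (e A) = {}"
    by metis
  \<comment> \<open>Only finitely many index sets are not contained in the active set of some point.\<close>
  define Bad where "Bad = {A. \<forall>y\<in>halfspace_Int \<eta> \<kappa>. \<not> A \<subseteq> active \<eta> \<kappa> y}"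
  define \<epsilon> where "\<epsilon> = Min (insert 1 (e ` Bad))"
  have "finite Bad" by (rule finite)
  then have \<epsilon>_le: "\<epsilon> \<le> e A" if "A \<in> Bad" for A
    using that by (simp add: \<epsilon>_def)
  show thesis
  proof (rule that)
    show "0 < \<epsilon>"
      using \<open>finite Bad\<close> e by (auto simp: \<epsilon>_def Bad_def)
    fix x assume x: "\<And>k. \<eta> k \<bullet> x \<le> \<kappa> $ k + \<epsilon>"
    let ?A = "{k. \<kappa> $ k - \<epsilon> \<le> \<eta> k \<bullet> x}"
    have "x \<in> G ?A \<epsilon>" using x by (auto simp: G_def)
    then have "?A \<notin> Bad"
      using G_mono [OF \<epsilon>_le [of ?A]] e [of ?A] unfolding Bad_def by blast
    then show "\<exists>y\<in>halfspace_Int \<eta> \<kappa>. ?A \<subseteq> active \<eta> \<kappa> y" by (auto simp: Bad_def)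
  qed
qed

section \<open>Simple polytopes\<close>

lemma simple_polytope_bounded: "simple_polytope \<eta> \<kappa> \<Longrightarrow> bounded (halfspace_Int \<eta> \<kappa>)"
  by (simp add: simple_polytope_def is_polytope_def)

lemma simple_polytope_vertex:
  fixes \<eta> :: "'n::finite \<Rightarrow> 'a::euclidean_space"
  assumes "simple_polytope \<eta> \<kappa>" and v: "v extreme_point_of halfspace_Int \<eta> \<kappa>"
  shows "v \<in> halfspace_Int \<eta> \<kappa>" "card (active \<eta> \<kappa> v) = DIM('a)"
    "span (\<eta> ` active \<eta> \<kappa> v) = UNIV" "inj_on \<eta> (active \<eta> \<kappa> v)" "independent (\<eta> ` active \<eta> \<kappa> v)"
proof -
  show mem: "v \<in> halfspace_Int \<eta> \<kappa>"
    using v by (simp add: extreme_point_of_def)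
  show card: "card (active \<eta> \<kappa> v) = DIM('a)"
    using assms unfolding simple_polytope_def active_facets [OF mem, symmetric] by blast
  show span: "span (\<eta> ` active \<eta> \<kappa> v) = UNIV"
    using extreme_point_iff_span_active [OF mem] v by simp
  have "DIM('a) \<le> card (\<eta> ` active \<eta> \<kappa> v)"
    using span dim_le_card [of UNIV "\<eta> ` active \<eta> \<kappa> v"] by simp
  moreover have "card (\<eta> ` active \<eta> \<kappa> v) \<le> card (active \<eta> \<kappa> v)"
    by (simp add: card_image_le)
  ultimately have card': "card (\<eta> ` active \<eta> \<kappa> v) = DIM('a)" using card by simp
  then show "inj_on \<eta> (active \<eta> \<kappa> v)" using card by (simp add: eq_card_imp_inj_on)
  show "independent (\<eta> ` active \<eta> \<kappa> v)"
    using card_le_dim_spanning [of "\<eta> ` active \<eta> \<kappa> v" UNIV] span card' by simp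
qed

text \<open>Since the conormals at a vertex are independent, one can move off the vertex changing the
  values of the active functionals at prescribed rates.\<close>

lemma perturb_vertex:
  fixes \<eta> :: "'n::finite \<Rightarrow> 'a::euclidean_space"
  assumes v: "v \<in> halfspace_Int \<eta> \<kappa>"
    and "inj_on \<eta> (active \<eta> \<kappa> v)" "independent (\<eta> ` active \<eta> \<kappa> v)" and "0 < (d::real)"
  obtains e x where "0 < e" "e < d" "\<And>l. l \<in> active \<eta> \<kappa> v \<Longrightarrow> \<eta> l \<bullet> x = \<kappa> $ l + e * g l"
    "\<And>l. l \<notin> active \<eta> \<kappa> v \<Longrightarrow> \<eta> l \<bullet> x < \<kappa> $ l"
proof -
  obtain z where z: "\<And>l. l \<in> active \<eta> \<kappa> v \<Longrightarrow> \<eta> l \<bullet> z = g l"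
    using independent_family_dual [OF assms(2,3), of g] by blast
  obtain e where e: "0 < e" "\<And>l. l \<notin> active \<eta> \<kappa> v \<Longrightarrow> e * \<bar>\<eta> l \<bullet> z\<bar> < \<kappa> $ l - \<eta> l \<bullet> v"
    using small_multiple [of "- active \<eta> \<kappa> v" "\<lambda>l. \<kappa> $ l - \<eta> l \<bullet> v" "\<lambda>l. \<bar>\<eta> l \<bullet> z\<bar>"]
      inner_less_if_inactive [OF v] by auto
  define e' where "e' = min e (d / 2)"
  show thesis
  proof (rule that [of e' "v + e' *\<^sub>R z"])
    show "0 < e'" "e' < d" using e(1) \<open>0 < d\<close> by (auto simp: e'_def)
    show "\<eta> l \<bullet> (v + e' *\<^sub>R z) = \<kappa> $ l + e' * g l" if "l \<in> active \<eta> \<kappa> v" for l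
      using that z by (simp add: inner_right_distrib active_def)
    show "\<eta> l \<bullet> (v + e' *\<^sub>R z) < \<kappa> $ l" if "l \<notin> active \<eta> \<kappa> v" for l
    proof -
      have "e' * (\<eta> l \<bullet> z) \<le> e' * \<bar>\<eta> l \<bullet> z\<bar>" using \<open>0 < e'\<close> by (intro mult_left_mono) auto
      also have "\<dots> \<le> e * \<bar>\<eta> l \<bullet> z\<bar>" by (intro mult_right_mono) (auto simp: e'_def)
      finally show ?thesis using e(2) [OF that] by (simp add: inner_right_distrib)
    qed
  qed
qed

lemma simple_polytope_facet_vertex:
  fixes \<eta> :: "'n::finite \<Rightarrow> 'a::euclidean_space"
  assumes sp: "simple_polytope \<eta> \<kappa>"
  obtains v where "v extreme_point_of halfspace_Int \<eta> \<kappa>" "i \<in> active \<eta> \<kappa> v"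
proof -
  obtain a b where "a \<noteq> 0" and ab: "affine hull (facet \<eta> \<kappa> i) = {x. a \<bullet> x = b}"
    using sp unfolding simple_polytope_def is_polytope_def spans_hyperplane_def by metis
  then have "(b / (a \<bullet> a)) *\<^sub>R a \<in> affine hull (facet \<eta> \<kappa> i)" by simp
  then obtain y where y: "y \<in> facet \<eta> \<kappa> i" by fastforce
  then have y': "y \<in> halfspace_Int \<eta> \<kappa>" "i \<in> active \<eta> \<kappa> y" by (auto simp: facet_def active_def)
  show thesis
    using active_subset_active_vertex [OF simple_polytope_bounded [OF sp] y'(1)] y'(2) that by blast
qed

lemma simple_polytope_facet_point:
  fixes \<eta> :: "'n::finite \<Rightarrow> 'a::euclidean_space"
  assumes sp: "simple_polytope \<eta> \<kappa>"
  obtains x where "\<eta> i \<bullet> x = \<kappa> $ i" "\<And>m. m \<noteq> i \<Longrightarrow> \<eta> m \<bullet> x < \<kappa> $ m"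
proof -
  obtain v where v: "v extreme_point_of halfspace_Int \<eta> \<kappa>" "i \<in> active \<eta> \<kappa> v"
    using simple_polytope_facet_vertex [OF sp] by blast
  obtain e x where "(0::real) < e" "e < 1"
    and x: "\<And>l. l \<in> active \<eta> \<kappa> v \<Longrightarrow> \<eta> l \<bullet> x = \<kappa> $ l + e * (if l = i then 0 else - 1)"
      "\<And>l. l \<notin> active \<eta> \<kappa> v \<Longrightarrow> \<eta> l \<bullet> x < \<kappa> $ l"
    using perturb_vertex [of v \<eta> \<kappa> 1 "\<lambda>l. if l = i then 0 else - 1"]
      simple_polytope_vertex [OF sp v(1)] by (metis zero_less_one)
  have "\<eta> m \<bullet> x < \<kappa> $ m" if "m \<noteq> i" for m
    using x(1) [of m] x(2) [of m] that \<open>0 < e\<close> by (cases "m \<in> active \<eta> \<kappa> v") auto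
  then show thesis using that [of x] x(1) [OF v(2)] by simp
qed

lemma simple_polytope_conormal_nonzero: "simple_polytope \<eta> \<kappa> \<Longrightarrow> \<eta> i \<noteq> 0"
  using simple_polytope_facet_vertex [of \<eta> \<kappa> i] simple_polytope_vertex(5)
  by (metis dependent_zero imageI)

lemma simple_polytope_interior_point:
  assumes sp: "simple_polytope \<eta> \<kappa>"
  obtains p where "\<And>k. \<eta> k \<bullet> p < \<kappa> $ k"
proof -
  have "halfspace_Int \<eta> \<kappa> \<noteq> {}"
    using sp unfolding simple_polytope_def is_polytope_def
    by (metis affine_hull_empty empty_not_UNIV)
  then obtain v where v: "v extreme_point_of halfspace_Int \<eta> \<kappa>"
    using active_subset_active_vertex [OF simple_polytope_bounded [OF sp]] by blast
  obtain e x where "(0::real) < e"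
    and x: "\<And>l. l \<in> active \<eta> \<kappa> v \<Longrightarrow> \<eta> l \<bullet> x = \<kappa> $ l + e * (- 1)"
      "\<And>l. l \<notin> active \<eta> \<kappa> v \<Longrightarrow> \<eta> l \<bullet> x < \<kappa> $ l"
    using perturb_vertex [of v \<eta> \<kappa> 1 "\<lambda>_. - 1"] simple_polytope_vertex [OF sp v]
    by (metis zero_less_one)
  show thesis
  proof (rule that)
    show "\<eta> m \<bullet> x < \<kappa> $ m" for m
      using x(1) [of m] x(2) [of m] \<open>0 < e\<close> by (cases "m \<in> active \<eta> \<kappa> v") auto
  qed
qed

lemma simple_polytope_bounded_change:
  assumes "simple_polytope \<eta> \<kappa>"
  shows "bounded (halfspace_Int \<eta> \<kappa>')"
  using simple_polytope_interior_point [OF assms]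
    bounded_halfspace_Int_change [OF simple_polytope_bounded [OF assms]] by metis

lemma open_strict_halfspaces:
  fixes \<eta> :: "'n::finite \<Rightarrow> 'a::euclidean_space"
  shows "open {x. \<forall>k\<in>K. \<eta> k \<bullet> x < c k}"
proof -
  have "{x. \<forall>k\<in>K. \<eta> k \<bullet> x < c k} = (\<Inter>k\<in>K. {x. \<eta> k \<bullet> x < c k})" by auto
  then show ?thesis by (auto intro: open_halfspace_lt)
qed

lemma simple_polytopeI:
  fixes \<eta> :: "'n::finite \<Rightarrow> 'a::euclidean_space"
  assumes "\<And>i. \<eta> i \<noteq> 0" and "bounded (halfspace_Int \<eta> \<kappa>)"
    and p: "\<And>k. \<eta> k \<bullet> p < \<kappa> $ k"
    and fp: "\<And>i. \<exists>x. \<eta> i \<bullet> x = \<kappa> $ i \<and> (\<forall>m. m \<noteq> i \<longrightarrow> \<eta> m \<bullet> x < \<kappa> $ m)"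
    and card: "\<And>v. v extreme_point_of halfspace_Int \<eta> \<kappa> \<Longrightarrow> card (active \<eta> \<kappa> v) = DIM('a)"
  shows "simple_polytope \<eta> \<kappa>"
proof -
  have "affine hull halfspace_Int \<eta> \<kappa> = UNIV"
  proof (rule affine_hull_nonempty_interior)
    have "p \<in> {x. \<forall>k\<in>UNIV. \<eta> k \<bullet> x < \<kappa> $ k}" using p by simp
    moreover have "{x. \<forall>k\<in>UNIV. \<eta> k \<bullet> x < \<kappa> $ k} \<subseteq> interior (halfspace_Int \<eta> \<kappa>)"
      by (intro interior_maximal open_strict_halfspaces) (auto simp: mem_halfspace_Int less_imp_le)
    ultimately show "interior (halfspace_Int \<eta> \<kappa>) \<noteq> {}" by blast
  qed
  moreover have "spans_hyperplane (facet \<eta> \<kappa> i)" for i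
  proof -
    let ?H = "{x. \<eta> i \<bullet> x = \<kappa> $ i}" and ?U = "{x. \<forall>k\<in>-{i}. \<eta> k \<bullet> x < \<kappa> $ k}"
    have "?H \<inter> ?U \<noteq> {}" using fp [of i] by auto
    then have "affine hull (?H \<inter> ?U) = ?H"
      using affine_hull_affine_Int_open [of ?H ?U] affine_hull_eq [of ?H]
        affine_hyperplane [of "\<eta> i" "\<kappa> $ i"] open_strict_halfspaces [of "- {i}" \<eta> "\<lambda>k. \<kappa> $ k"]
      by simp
    moreover have "?H \<inter> ?U \<subseteq> facet \<eta> \<kappa> i"
    proof
      fix x assume x: "x \<in> ?H \<inter> ?U"
      have "\<eta> k \<bullet> x \<le> \<kappa> $ k" for k
        using x by (cases "k = i") (auto intro: less_imp_le)
      then show "x \<in> facet \<eta> \<kappa> i" using x by (simp add: facet_def mem_halfspace_Int)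
    qed
    ultimately have "?H \<subseteq> affine hull (facet \<eta> \<kappa> i)"
      using hull_mono [of "?H \<inter> ?U" "facet \<eta> \<kappa> i" affine] by simp
    moreover have "affine hull (facet \<eta> \<kappa> i) \<subseteq> ?H"
      by (intro hull_minimal affine_hyperplane) (auto simp: facet_def)
    ultimately show ?thesis
      using assms(1) [of i] unfolding spans_hyperplane_def by (metis subset_antisym)
  qed
  moreover have "card {i. v \<in> facet \<eta> \<kappa> i} = DIM('a)"
    if "v extreme_point_of halfspace_Int \<eta> \<kappa>" for v
    using card [OF that] active_facets [of v \<eta> \<kappa>] that by (simp add: extreme_point_of_def)
  ultimately show ?thesis
    using assms(2) by (simp add: simple_polytope_def is_polytope_def)
qed

text \<open>At a vertex of a nearby polytope the active conormals span, and their indices are contained in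
  the active set of a vertex of the given polytope; hence there are exactly \<open>DIM('a)\<close> of them.\<close>

lemma simple_polytope_open:
  fixes \<eta> :: "'n::finite \<Rightarrow> 'a::euclidean_space"
  assumes sp: "simple_polytope \<eta> \<kappa>"
  obtains \<epsilon> where "0 < \<epsilon>" "\<And>\<kappa>'. (\<And>m. \<bar>\<kappa>' $ m - \<kappa> $ m\<bar> \<le> \<epsilon>) \<Longrightarrow> simple_polytope \<eta> \<kappa>'"
proof -
  have nz: "\<eta> i \<noteq> 0" for i using simple_polytope_conormal_nonzero [OF sp] .
  obtain \<epsilon>1 where \<epsilon>1: "0 < \<epsilon>1"
    "\<And>x. (\<And>k. \<eta> k \<bullet> x \<le> \<kappa> $ k + \<epsilon>1) \<Longrightarrow>
      \<exists>y\<in>halfspace_Int \<eta> \<kappa>. {k. \<kappa> $ k - \<epsilon>1 \<le> \<eta> k \<bullet> x} \<subseteq> active \<eta> \<kappa> y"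
    using near_active_subset_active [OF simple_polytope_bounded_change [OF sp]] by blast
  obtain p where p: "\<And>k. \<eta> k \<bullet> p < \<kappa> $ k" using simple_polytope_interior_point [OF sp] by blast
  obtain \<epsilon>2 where \<epsilon>2: "0 < \<epsilon>2" "\<And>k. \<epsilon>2 < \<kappa> $ k - \<eta> k \<bullet> p"
    using small_multiple [of UNIV "\<lambda>k. \<kappa> $ k - \<eta> k \<bullet> p" "\<lambda>_. 1"] p by auto
  obtain X where X: "\<And>i. \<eta> i \<bullet> X i = \<kappa> $ i" "\<And>i m. m \<noteq> i \<Longrightarrow> \<eta> m \<bullet> X i < \<kappa> $ m"
  proof -
    have "\<exists>x. \<eta> i \<bullet> x = \<kappa> $ i \<and> (\<forall>m. m \<noteq> i \<longrightarrow> \<eta> m \<bullet> x < \<kappa> $ m)" for i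
      using simple_polytope_facet_point [OF sp, of i] by metis
    then show thesis using that by metis
  qed
  define C where "C i m = 1 + \<bar>\<eta> m \<bullet> \<eta> i\<bar> / (\<eta> i \<bullet> \<eta> i)" for i m
  obtain \<epsilon>3 where \<epsilon>3: "0 < \<epsilon>3" "\<And>i m. m \<noteq> i \<Longrightarrow> \<epsilon>3 * C i m < \<kappa> $ m - \<eta> m \<bullet> X i"
  proof -
    define D where "D q = \<kappa> $ snd q - \<eta> (snd q) \<bullet> X (fst q)" for q
    have "0 < D q" if "q \<in> {q. snd q \<noteq> fst q}" for q
      using X(2) [of "snd q" "fst q"] that by (simp add: D_def)
    then obtain e where e: "0 < e" "\<And>q. q \<in> {q. snd q \<noteq> fst q} \<Longrightarrow> e * C (fst q) (snd q) < D q"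
      using small_multiple [of "{q. snd q \<noteq> fst q}" D "\<lambda>q. C (fst q) (snd q)"] by auto
    show thesis
    proof (rule that [OF e(1)])
      show "e * C i m < \<kappa> $ m - \<eta> m \<bullet> X i" if "m \<noteq> i" for i m
        using e(2) [of "(i, m)"] that by (simp add: D_def)
    qed
  qed
  define \<epsilon> where "\<epsilon> = min \<epsilon>1 (min \<epsilon>2 \<epsilon>3)"
  have "simple_polytope \<eta> \<kappa>'" if near: "\<And>m. \<bar>\<kappa>' $ m - \<kappa> $ m\<bar> \<le> \<epsilon>" for \<kappa>'
  proof (rule simple_polytopeI)
    show "\<eta> i \<noteq> 0" for i by (rule nz)
    show "bounded (halfspace_Int \<eta> \<kappa>')" by (rule simple_polytope_bounded_change [OF sp])
    show "\<eta> k \<bullet> p < \<kappa>' $ k" for k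
      using \<epsilon>2(2) [of k] near [of k] by (auto simp: \<epsilon>_def)
    show "\<exists>x. \<eta> i \<bullet> x = \<kappa>' $ i \<and> (\<forall>m. m \<noteq> i \<longrightarrow> \<eta> m \<bullet> x < \<kappa>' $ m)" for i
    proof (intro exI conjI allI impI)
      let ?x = "X i + ((\<kappa>' $ i - \<kappa> $ i) / (\<eta> i \<bullet> \<eta> i)) *\<^sub>R \<eta> i"
      show "\<eta> i \<bullet> ?x = \<kappa>' $ i" using X(1) nz [of i] by (simp add: inner_right_distrib)
      fix m assume "m \<noteq> i"
      have "(\<kappa>' $ i - \<kappa> $ i) / (\<eta> i \<bullet> \<eta> i) * (\<eta> m \<bullet> \<eta> i)
          \<le> \<bar>(\<kappa>' $ i - \<kappa> $ i) / (\<eta> i \<bullet> \<eta> i) * (\<eta> m \<bullet> \<eta> i)\<bar>" by (rule abs_ge_self)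
      also have "\<dots> = \<bar>\<kappa>' $ i - \<kappa> $ i\<bar> * (\<bar>\<eta> m \<bullet> \<eta> i\<bar> / (\<eta> i \<bullet> \<eta> i))" by (simp add: abs_mult)
      also have "\<dots> \<le> \<epsilon>3 * (\<bar>\<eta> m \<bullet> \<eta> i\<bar> / (\<eta> i \<bullet> \<eta> i))"
        using near [of i] by (intro mult_right_mono) (auto simp: \<epsilon>_def)
      finally have "\<eta> m \<bullet> ?x \<le> \<eta> m \<bullet> X i + \<epsilon>3 * (\<bar>\<eta> m \<bullet> \<eta> i\<bar> / (\<eta> i \<bullet> \<eta> i))"
        by (simp add: inner_right_distrib)
      also have "\<dots> < \<kappa> $ m - \<epsilon>3"
        using \<epsilon>3(2) [OF \<open>m \<noteq> i\<close>] by (simp add: C_def algebra_simps)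
      also have "\<dots> \<le> \<kappa>' $ m" using near [of m] by (auto simp: \<epsilon>_def)
      finally show "\<eta> m \<bullet> ?x < \<kappa>' $ m" .
    qed
  next
    fix v assume v: "v extreme_point_of halfspace_Int \<eta> \<kappa>'"
    then have mem: "v \<in> halfspace_Int \<eta> \<kappa>'" by (simp add: extreme_point_of_def)
    have "\<eta> k \<bullet> v \<le> \<kappa> $ k + \<epsilon>1" for k
      using mem near [of k] unfolding mem_halfspace_Int by (smt (verit) \<epsilon>_def)
    then obtain y where y: "y \<in> halfspace_Int \<eta> \<kappa>" "{k. \<kappa> $ k - \<epsilon>1 \<le> \<eta> k \<bullet> v} \<subseteq> active \<eta> \<kappa> y"
      using \<epsilon>1(2) by blast
    obtain w where w: "w extreme_point_of halfspace_Int \<eta> \<kappa>" "active \<eta> \<kappa> y \<subseteq> active \<eta> \<kappa> w"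
      using active_subset_active_vertex [OF simple_polytope_bounded [OF sp] y(1)] by blast
    have "\<kappa> $ k - \<epsilon>1 \<le> \<eta> k \<bullet> v" if "k \<in> active \<eta> \<kappa>' v" for k
      using that near [of k] unfolding active_def by (smt (verit) \<epsilon>_def mem_Collect_eq)
    then have "active \<eta> \<kappa>' v \<subseteq> active \<eta> \<kappa> w" using y(2) w(2) by blast
    then have "card (active \<eta> \<kappa>' v) \<le> DIM('a)"
      using simple_polytope_vertex(2) [OF sp w(1)] by (metis card_mono finite)
    moreover have "DIM('a) \<le> card (active \<eta> \<kappa>' v)"
    proof -
      have "DIM('a) \<le> card (\<eta> ` active \<eta> \<kappa>' v)"
        using v extreme_point_iff_span_active [OF mem]
          dim_le_card [of UNIV "\<eta> ` active \<eta> \<kappa>' v"] by simp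
      also have "\<dots> \<le> card (active \<eta> \<kappa>' v)" by (simp add: card_image_le)
      finally show ?thesis .
    qed
    ultimately show "card (active \<eta> \<kappa>' v) = DIM('a)" by simp
  qed
  moreover have "0 < \<epsilon>" using \<epsilon>1(1) \<epsilon>2(1) \<epsilon>3(1) by (simp add: \<epsilon>_def)
  ultimately show thesis using that by blast
qed

lemma chamber_contains_box:
  fixes \<eta> :: "'n::finite \<Rightarrow> 'a::euclidean_space"
  assumes "simple_polytope \<eta> \<kappa>"
  obtains \<epsilon> where "0 < \<epsilon>" "\<And>\<kappa>'. (\<And>m. \<bar>\<kappa>' $ m - \<kappa> $ m\<bar> \<le> \<epsilon>) \<Longrightarrow> \<kappa>' \<in> chamber \<eta> \<kappa>"
    "\<And>\<kappa>'. (\<And>m. \<bar>\<kappa>' $ m - \<kappa> $ m\<bar> \<le> \<epsilon>) \<Longrightarrow> simple_polytope \<eta> \<kappa>'"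
proof -
  obtain \<epsilon> where \<epsilon>: "0 < \<epsilon>" "\<And>\<kappa>'. (\<And>m. \<bar>\<kappa>' $ m - \<kappa> $ m\<bar> \<le> \<epsilon>) \<Longrightarrow> simple_polytope \<eta> \<kappa>'"
    using simple_polytope_open [OF assms] by blast
  let ?Q = "cbox (\<kappa> - (\<chi> m. \<epsilon>)) (\<kappa> + (\<chi> m. \<epsilon>))"
  have Q: "\<kappa>' \<in> ?Q \<longleftrightarrow> (\<forall>m. \<bar>\<kappa>' $ m - \<kappa> $ m\<bar> \<le> \<epsilon>)" for \<kappa>'
    unfolding mem_box_cart by (auto simp: abs_le_iff algebra_simps)
  have "?Q \<subseteq> chamber \<eta> \<kappa>"
    unfolding chamber_def
    by (rule connected_component_maximal)
      (use \<epsilon> in \<open>auto simp: Q intro!: convex_connected simp del: mem_box_cart\<close>)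
  then show thesis using that \<epsilon> Q by blast
qed

section \<open>Edges of simple polytopes\<close>

text \<open>Relaxing the inequality \<open>k\<close> at the vertex \<open>v\<close> and following the edge direction \<open>u\<close> leads to an
  adjacent vertex, where a single new inequality \<open>k'\<close> has become an equality.\<close>

lemma simple_polytope_edge:
  fixes \<eta> :: "'n::finite \<Rightarrow> 'a::euclidean_space"
  assumes sp: "simple_polytope \<eta> \<kappa>" and v: "v extreme_point_of halfspace_Int \<eta> \<kappa>"
    and k: "k \<in> active \<eta> \<kappa> v"
    and u: "\<And>l. l \<in> active \<eta> \<kappa> v - {k} \<Longrightarrow> \<eta> l \<bullet> u = 0" "\<eta> k \<bullet> u = - 1"
  obtains T k' where "0 < T" "k' \<notin> active \<eta> \<kappa> v" "0 < \<eta> k' \<bullet> u"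
    "(v + T *\<^sub>R u) extreme_point_of halfspace_Int \<eta> \<kappa>"
    "active \<eta> \<kappa> (v + T *\<^sub>R u) = insert k' (active \<eta> \<kappa> v - {k})"
proof -
  let ?B = "active \<eta> \<kappa> v"
  define N where "N = {m. m \<notin> ?B \<and> 0 < \<eta> m \<bullet> u}"
  define \<tau> where "\<tau> m = (\<kappa> $ m - \<eta> m \<bullet> v) / (\<eta> m \<bullet> u)" for m
  note vertex = simple_polytope_vertex [OF sp v]
  have mem: "v + s *\<^sub>R u \<in> halfspace_Int \<eta> \<kappa>" if "0 \<le> s" "\<And>m. m \<in> N \<Longrightarrow> s \<le> \<tau> m" for s
    unfolding mem_halfspace_Int
  proof
    fix m
    have le: "\<eta> m \<bullet> v \<le> \<kappa> $ m" using vertex(1) by (simp add: mem_halfspace_Int)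
    show "\<eta> m \<bullet> (v + s *\<^sub>R u) \<le> \<kappa> $ m"
    proof (cases "m \<in> N")
      case True
      then show ?thesis
        using that(2) [of m] by (simp add: N_def \<tau>_def inner_right_distrib pos_le_divide_eq)
    next
      case False
      then have "\<eta> m \<bullet> u \<le> 0" using u by (cases "m = k") (auto simp: N_def)
      then have "s * (\<eta> m \<bullet> u) \<le> 0" using that(1) by (rule mult_nonneg_nonpos [rotated])
      then show ?thesis using le by (simp add: inner_right_distrib)
    qed
  qed
  \<comment> \<open>Otherwise the ray from \<open>v\<close> in the direction \<open>u\<close> would stay in the bounded polytope.\<close>
  have "N \<noteq> {}"
  proof
    assume "N = {}"
    obtain b where b: "0 < b" "\<And>x. x \<in> halfspace_Int \<eta> \<kappa> \<Longrightarrow> norm x \<le> b"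
      using simple_polytope_bounded [OF sp] bounded_pos by metis
    have "norm (\<eta> k) > 0" using simple_polytope_conormal_nonzero [OF sp] by simp
    define s where "s = norm (\<eta> k) * b + \<bar>\<kappa> $ k\<bar> + 1"
    have "0 \<le> s" using b(1) by (simp add: s_def)
    then have "norm (v + s *\<^sub>R u) \<le> b" using b(2) mem \<open>N = {}\<close> by blast
    moreover have "\<bar>\<eta> k \<bullet> (v + s *\<^sub>R u)\<bar> \<le> norm (\<eta> k) * norm (v + s *\<^sub>R u)"
      by (rule Cauchy_Schwarz_ineq2)
    ultimately have "\<bar>\<eta> k \<bullet> (v + s *\<^sub>R u)\<bar> \<le> norm (\<eta> k) * b"
      using \<open>norm (\<eta> k) > 0\<close> by (meson mult_left_mono norm_ge_zero order_trans)
    moreover have "\<eta> k \<bullet> (v + s *\<^sub>R u) = \<kappa> $ k - s"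
      using k u(2) by (simp add: inner_right_distrib active_def)
    ultimately show False by (simp add: s_def)
  qed
  then obtain k' where k': "k' \<in> N" "\<And>m. m \<in> N \<Longrightarrow> \<tau> k' \<le> \<tau> m"
    using ex_min_if_finite [of "\<tau> ` N"] by (auto simp: not_less)
  have "0 < \<tau> k'"
    using k'(1) inner_less_if_inactive [OF vertex(1), of k'] by (auto simp: N_def \<tau>_def)
  define v' where "v' = v + \<tau> k' *\<^sub>R u"
  have v'_mem: "v' \<in> halfspace_Int \<eta> \<kappa>"
    unfolding v'_def using mem k'(2) \<open>0 < \<tau> k'\<close> by simp
  have k'_pos: "0 < \<eta> k' \<bullet> u" and k'_notin: "k' \<notin> ?B" using k'(1) by (auto simp: N_def)
  have sub: "insert k' (?B - {k}) \<subseteq> active \<eta> \<kappa> v'"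
    using u(1) k'_pos by (auto simp: active_def v'_def inner_right_distrib \<tau>_def)
  have "k \<notin> active \<eta> \<kappa> v'"
    using k u(2) \<open>0 < \<tau> k'\<close> by (auto simp: active_def v'_def inner_right_distrib)
  have "span (\<eta> ` insert k' (?B - {k})) = UNIV"
  proof (rule ccontr)
    assume "\<not> ?thesis"
    then have "dim (\<eta> ` insert k' (?B - {k})) < DIM('a)"
      by (metis dim_eq_full dim_subset_UNIV le_neq_implies_less)
    then obtain z where z: "z \<noteq> 0" "\<And>y. y \<in> span (\<eta> ` insert k' (?B - {k})) \<Longrightarrow> orthogonal z y"
      using orthogonal_to_subspace_exists by metis
    have z0: "\<eta> l \<bullet> z = 0" if "l \<in> insert k' (?B - {k})" for l
      using z(2) [OF span_base [OF imageI [OF that]]] by (simp add: orthogonal_def inner_commute)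
    have "z = - (\<eta> k \<bullet> z) *\<^sub>R u"
    proof (rule spanning_family_eqI [OF vertex(3)])
      fix l assume "l \<in> ?B"
      then show "\<eta> l \<bullet> z = \<eta> l \<bullet> (- (\<eta> k \<bullet> z) *\<^sub>R u)"
        using z0 [of l] u by (cases "l = k") auto
    qed
    then show False
      using z0 [of k'] z(1) k'_pos by (metis inner_scaleR_right insertI1 mult_eq_0_iff less_irrefl
          scaleR_zero_left)
  qed
  then have "span (\<eta> ` active \<eta> \<kappa> v') = UNIV"
    using span_mono [OF image_mono [OF sub], of \<eta>] by blast
  then have ext: "v' extreme_point_of halfspace_Int \<eta> \<kappa>"
    using extreme_point_iff_span_active [OF v'_mem] by simp
  have "card (insert k' (?B - {k})) = card (active \<eta> \<kappa> v')"
    using simple_polytope_vertex(2) [OF sp ext] vertex(2) k k'_notin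
    by (simp add: card_Suc_Diff1)
  then have "insert k' (?B - {k}) = active \<eta> \<kappa> v'" by (intro card_subset_eq sub) auto
  then show thesis
    using that [of "\<tau> k'" k'] \<open>0 < \<tau> k'\<close> k'_notin k'_pos ext by (simp add: v'_def)
qed

lemma active_on_edge:
  fixes \<eta> :: "'n::finite \<Rightarrow> 'a::euclidean_space"
  assumes sp: "simple_polytope \<eta> \<kappa>" and v: "v extreme_point_of halfspace_Int \<eta> \<kappa>"
    and k: "k \<in> active \<eta> \<kappa> v"
    and u: "\<And>l. l \<in> active \<eta> \<kappa> v - {k} \<Longrightarrow> \<eta> l \<bullet> u = 0" "\<eta> k \<bullet> u = - 1"
    and k': "k' \<notin> active \<eta> \<kappa> v" "0 < \<eta> k' \<bullet> u"
    and act: "active \<eta> \<kappa> (v + T *\<^sub>R u) = insert k' (active \<eta> \<kappa> v - {k})"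
    and mem: "v + T *\<^sub>R u \<in> halfspace_Int \<eta> \<kappa>"
    and y: "y \<in> halfspace_Int \<eta> \<kappa>" "active \<eta> \<kappa> v - {k} \<subseteq> active \<eta> \<kappa> y"
  shows "active \<eta> \<kappa> y \<subseteq> insert k' (active \<eta> \<kappa> v)"
proof
  fix m assume m: "m \<in> active \<eta> \<kappa> y"
  let ?B = "active \<eta> \<kappa> v"
  note vertex = simple_polytope_vertex [OF sp v]
  define s where "s = \<kappa> $ k - \<eta> k \<bullet> y"
  have "0 \<le> s" using y(1) by (simp add: s_def mem_halfspace_Int)
  have y_eq: "y = v + s *\<^sub>R u"
  proof (rule spanning_family_eqI [OF vertex(3)])
    fix l assume l: "l \<in> ?B"
    show "\<eta> l \<bullet> y = \<eta> l \<bullet> (v + s *\<^sub>R u)"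
    proof (cases "l = k")
      case True
      then show ?thesis using l u(2) by (simp add: s_def inner_right_distrib active_def)
    next
      case False
      then have "l \<in> active \<eta> \<kappa> y" using l y(2) by blast
      then show ?thesis using l u(1) [of l] False by (simp add: inner_right_distrib active_def)
    qed
  qed
  have "s \<le> T"
  proof -
    have "\<eta> k' \<bullet> y \<le> \<eta> k' \<bullet> (v + T *\<^sub>R u)"
    proof -
      have "k' \<in> active \<eta> \<kappa> (v + T *\<^sub>R u)" using act by simp
      then show ?thesis using y(1) by (simp add: mem_halfspace_Int active_def)
    qed
    then show ?thesis using k'(2) by (simp add: y_eq inner_right_distrib)
  qed
  show "m \<in> insert k' ?B"
  proof (rule ccontr)
    assume neg: "m \<notin> insert k' ?B"
    then have "m \<notin> active \<eta> \<kappa> (v + T *\<^sub>R u)" using act by blast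
    then have "\<eta> m \<bullet> (v + T *\<^sub>R u) < \<kappa> $ m" using inner_less_if_inactive [OF mem] by blast
    moreover have "\<eta> m \<bullet> v < \<kappa> $ m" using inner_less_if_inactive [OF vertex(1)] neg by blast
    moreover have "\<eta> m \<bullet> v + s * (\<eta> m \<bullet> u) = \<kappa> $ m"
      using m by (simp add: active_def y_eq inner_right_distrib)
    ultimately have "s * (\<eta> m \<bullet> u) > T * (\<eta> m \<bullet> u)" "s * (\<eta> m \<bullet> u) > 0"
      by (auto simp: inner_right_distrib)
    moreover from this(2) have "0 < \<eta> m \<bullet> u" using \<open>0 \<le> s\<close> by (simp add: zero_less_mult_iff)
    ultimately show False using \<open>s \<le> T\<close> by (simp add: mult_less_cancel_right_disj)
  qed
qed

section \<open>Finite differences of volumes and moments\<close>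

lemma measure_lborel_strict_mono:
  fixes S T U :: "'a::euclidean_space set"
  assumes "S \<in> sets borel" "T \<in> sets borel" "S \<subseteq> T" "bounded T"
    and U: "open U" "U \<noteq> {}" "U \<subseteq> T - S"
  shows "measure lborel S < measure lborel T"
proof -
  have fin: "emeasure lborel A \<noteq> \<infinity>" if "A \<subseteq> T" for A
    using emeasure_bounded_finite [of A] bounded_subset [OF assms(4) that] by auto
  have "emeasure lborel U \<noteq> 0"
    using U(1,2) open_not_negligible [of U] by (auto simp: negligible_iff_null_sets null_sets_def)
  then have "0 < measure lborel U"
    using fin [of U] order_trans [OF U(3) Diff_subset] by (simp add: measure_def enn2real_positive_iff less_top zero_less_iff_neq_zero)
  also have "\<dots> \<le> measure lborel (T - S)"
    using U assms fin by (intro measure_mono_fmeasurable) (auto simp: fmeasurable_def less_top)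
  also have "\<dots> = measure lborel T - measure lborel S"
    using assms fin by (intro measure_Diff) auto
  finally show ?thesis by simp
qed

lemma measure_lborel_translation:
  fixes S :: "'a::euclidean_space set"
  assumes "S \<in> sets borel"
  shows "measure lborel {x. x + a \<in> S} = measure lborel S"
proof -
  have "measure lborel S = measure (distr lborel borel ((+) a)) S"
    by (simp add: lborel_distr_plus)
  also have "\<dots> = measure lborel {x. x + a \<in> S}"
    using assms by (subst measure_distr) (auto simp: vimage_def add.commute)
  finally show ?thesis by simp
qed

lemma set_integral_Un_Int_compact:
  fixes g :: "'a::euclidean_space \<Rightarrow> 'b::{banach, second_countable_topology}"
  assumes "compact A" "compact B" "continuous_on UNIV g"
  shows "(LINT x:A \<union> B|lborel. g x) + (LINT x:A \<inter> B|lborel. g x)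
    = (LINT x:A|lborel. g x) + (LINT x:B|lborel. g x)"
proof -
  have int: "integrable lborel (\<lambda>x. indicator C x *\<^sub>R g x)" if "compact C" for C
    using that assms(3) by (intro borel_integrable_compact) (auto intro: continuous_on_subset)
  have "indicator (A \<union> B) x *\<^sub>R g x + indicator (A \<inter> B) x *\<^sub>R g x
      = indicator A x *\<^sub>R g x + indicator B x *\<^sub>R g x" for x
    by (auto simp: indicator_def)
  then show ?thesis
    unfolding set_lebesgue_integral_def
    using int [OF assms(1)] int [OF assms(2)] int [OF compact_Un [OF assms(1,2)]]
      int [OF compact_Int [OF assms(1,2)]]
    by (simp flip: Bochner_Integration.integral_add)
qed

lemma measure_eq_set_integral:
  "measure lborel A = (LINT x:A|lborel. (1::real))" if "A \<in> sets lborel"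
  using that by (simp add: set_lebesgue_integral_def)

lemma axis_nth_if: "axis i s $ m = (if m = i then s else 0)"
  by (simp add: axis_def)

text \<open>If the polyhedron with the inequalities \<open>i\<close> and \<open>j\<close> relaxed has no point on or beyond both of
  the original hyperplanes, then it is the union of the polyhedra with only one of them relaxed, and
  the mixed difference of the integral vanishes. For facets that do not meet, this applies to small
  relaxations.\<close>

lemma mixed_difference_zero:
  fixes \<eta> :: "'n::finite \<Rightarrow> 'a::euclidean_space"
    and g :: "'a \<Rightarrow> 'b::{banach, second_countable_topology}"
  assumes bdd: "\<And>\<kappa>'. bounded (halfspace_Int \<eta> \<kappa>')" and g: "continuous_on UNIV g"
    and ij: "i \<noteq> j" "0 \<le> s" "0 \<le> r"
    and disj: "\<And>x. x \<in> halfspace_Int \<eta> (\<kappa> + axis i s + axis j r) \<Longrightarrow>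
      \<eta> i \<bullet> x < \<kappa> $ i \<or> \<eta> j \<bullet> x < \<kappa> $ j"
  shows "(LINT x:halfspace_Int \<eta> (\<kappa> + axis i s + axis j r)|lborel. g x)
      + (LINT x:halfspace_Int \<eta> \<kappa>|lborel. g x)
    = (LINT x:halfspace_Int \<eta> (\<kappa> + axis i s)|lborel. g x)
      + (LINT x:halfspace_Int \<eta> (\<kappa> + axis j r)|lborel. g x)"
proof -
  let ?A = "halfspace_Int \<eta> (\<kappa> + axis i s)" and ?B = "halfspace_Int \<eta> (\<kappa> + axis j r)"
  define R where "R x \<longleftrightarrow> (\<forall>m. m \<noteq> i \<and> m \<noteq> j \<longrightarrow> \<eta> m \<bullet> x \<le> \<kappa> $ m)" for x
  have *: "x \<in> halfspace_Int \<eta> (\<kappa> + axis i s + axis j r) \<longleftrightarrow>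
      R x \<and> \<eta> i \<bullet> x \<le> \<kappa> $ i + s \<and> \<eta> j \<bullet> x \<le> \<kappa> $ j + r"
    "x \<in> ?A \<longleftrightarrow> R x \<and> \<eta> i \<bullet> x \<le> \<kappa> $ i + s \<and> \<eta> j \<bullet> x \<le> \<kappa> $ j"
    "x \<in> ?B \<longleftrightarrow> R x \<and> \<eta> i \<bullet> x \<le> \<kappa> $ i \<and> \<eta> j \<bullet> x \<le> \<kappa> $ j + r"
    "x \<in> halfspace_Int \<eta> \<kappa> \<longleftrightarrow>
      R x \<and> \<eta> i \<bullet> x \<le> \<kappa> $ i \<and> \<eta> j \<bullet> x \<le> \<kappa> $ j" for x
    using ij(1) unfolding mem_halfspace_Int axis_nth_if R_def vector_add_component
    by (smt (verit))+
  have "halfspace_Int \<eta> (\<kappa> + axis i s + axis j r) = ?A \<union> ?B"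
    using disj ij(2,3) unfolding set_eq_iff Un_iff * by (smt (verit))
  moreover have "halfspace_Int \<eta> \<kappa> = ?A \<inter> ?B"
    using ij(2,3) unfolding set_eq_iff Int_iff * by (smt (verit))
  moreover have "compact ?A" "compact ?B"
    using bdd closed_halfspace_Int by (auto simp: compact_eq_bounded_closed)
  ultimately show ?thesis using set_integral_Un_Int_compact g by metis
qed

text \<open>The part of the polyhedron with support numbers \<open>\<kappa> + t \<cdot> 1\<^sub>K\<close> that lies beyond all the
  hyperplanes of \<open>\<kappa>\<close> with index in \<open>K\<close>; its volume is the iterated difference of the volume in
  the directions in \<open>K\<close>.\<close>

definition sliver ::
  "('n::finite \<Rightarrow> 'a::euclidean_space) \<Rightarrow> real ^ 'n \<Rightarrow> real \<Rightarrow> 'n set \<Rightarrow> 'a set" where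
  "sliver \<eta> \<kappa> t K = {x. \<forall>m. if m \<in> K then \<kappa> $ m < \<eta> m \<bullet> x \<and> \<eta> m \<bullet> x \<le> \<kappa> $ m + t
      else \<eta> m \<bullet> x \<le> \<kappa> $ m}"

lemma sliver_empty [simp]: "sliver \<eta> \<kappa> t {} = halfspace_Int \<eta> \<kappa>"
  by (auto simp: sliver_def mem_halfspace_Int)

lemma sliver_measurable [measurable]: "sliver \<eta> \<kappa> t K \<in> sets borel"
proof -
  have "sliver \<eta> \<kappa> t K =
      {x. (\<forall>m\<in>K. \<kappa> $ m < \<eta> m \<bullet> x \<and> \<eta> m \<bullet> x \<le> \<kappa> $ m + t) \<and> (\<forall>m\<in>-K. \<eta> m \<bullet> x \<le> \<kappa> $ m)}"
    by (auto simp: sliver_def)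
  also have "\<dots> \<in> sets borel" by measurable
  finally show ?thesis .
qed

lemma bounded_sliver:
  assumes "\<And>\<kappa>'. bounded (halfspace_Int \<eta> \<kappa>')" "0 \<le> t"
  shows "bounded (sliver \<eta> \<kappa> t K)"
proof (rule bounded_subset)
  show "sliver \<eta> \<kappa> t K \<subseteq> halfspace_Int \<eta> (\<chi> m. \<kappa> $ m + t)"
    using assms(2) unfolding sliver_def mem_halfspace_Int subset_iff by (simp, smt (verit))
qed (rule assms(1))

lemma measure_sliver_insert:
  assumes bdd: "\<And>\<kappa>'. bounded (halfspace_Int \<eta> \<kappa>')" and "0 \<le> t" "k \<notin> K"
  shows "measure lborel (sliver \<eta> \<kappa> t (insert k K))
    = measure lborel (sliver \<eta> (\<kappa> + axis k t) t K) - measure lborel (sliver \<eta> \<kappa> t K)"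
proof -
  define R where "R x \<longleftrightarrow> (\<forall>m. m \<noteq> k \<longrightarrow>
      (if m \<in> K then \<kappa> $ m < \<eta> m \<bullet> x \<and> \<eta> m \<bullet> x \<le> \<kappa> $ m + t else \<eta> m \<bullet> x \<le> \<kappa> $ m))" for x
  have *: "x \<in> sliver \<eta> (\<kappa> + axis k t) t K \<longleftrightarrow> \<eta> k \<bullet> x \<le> \<kappa> $ k + t \<and> R x"
    "x \<in> sliver \<eta> \<kappa> t K \<longleftrightarrow> \<eta> k \<bullet> x \<le> \<kappa> $ k \<and> R x"
    "x \<in> sliver \<eta> \<kappa> t (insert k K) \<longleftrightarrow> \<kappa> $ k < \<eta> k \<bullet> x \<and> \<eta> k \<bullet> x \<le> \<kappa> $ k + t \<and> R x"
    for x
    using assms(3) unfolding sliver_def mem_Collect_eq axis_nth_if R_def vector_add_component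
    by (smt (verit) insert_iff)+
  have "sliver \<eta> \<kappa> t (insert k K) = sliver \<eta> (\<kappa> + axis k t) t K - sliver \<eta> \<kappa> t K"
    unfolding set_eq_iff Diff_iff * by (smt (verit))
  moreover have "sliver \<eta> \<kappa> t K \<subseteq> sliver \<eta> (\<kappa> + axis k t) t K"
    using assms(2) unfolding subset_iff * by (smt (verit))
  moreover have "emeasure lborel (sliver \<eta> (\<kappa> + axis k t) t K) \<noteq> \<infinity>"
    using emeasure_bounded_finite [OF bounded_sliver [OF bdd \<open>0 \<le> t\<close>]] by (simp add: less_top)
  ultimately show ?thesis by (simp add: measure_Diff)
qed

text \<open>If the second difference of the volume in the direction \<open>i\<close> vanishes near \<open>\<kappa>\<close>, then so do
  the second differences of all its iterated differences.\<close>

lemma second_difference_sliver: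
  fixes \<eta> :: "'n::finite \<Rightarrow> 'a::euclidean_space"
  assumes bdd: "\<And>\<kappa>'. bounded (halfspace_Int \<eta> \<kappa>')" and "0 \<le> t" and "i \<notin> K"
    and sd: "\<And>\<kappa>'. \<lbrakk>\<And>m. \<kappa> $ m \<le> \<kappa>' $ m; \<And>m. \<kappa>' $ m \<le> \<kappa> $ m + t\<rbrakk> \<Longrightarrow>
      measure lborel (halfspace_Int \<eta> (\<kappa>' + axis i (2 * t))) + measure lborel (halfspace_Int \<eta> \<kappa>')
        = 2 * measure lborel (halfspace_Int \<eta> (\<kappa>' + axis i t))"
    and "\<And>m. \<kappa> $ m \<le> \<kappa>' $ m" "\<And>m. \<kappa>' $ m \<le> \<kappa> $ m + t"
    and "\<And>m. m \<in> K \<Longrightarrow> \<kappa>' $ m = \<kappa> $ m"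
  shows "measure lborel (sliver \<eta> (\<kappa>' + axis i (2 * t)) t K) + measure lborel (sliver \<eta> \<kappa>' t K)
    = 2 * measure lborel (sliver \<eta> (\<kappa>' + axis i t) t K)"
proof -
  have "finite K" by simp
  then show ?thesis using assms(3,5-7)
  proof (induction K arbitrary: \<kappa>' rule: finite_induct)
    case empty
    then show ?case using sd by simp
  next
    case (insert k K)
    have "i \<notin> K" using insert.prems(1) by simp
    have 1: "measure lborel (sliver \<eta> (\<kappa>' + axis i (2 * t)) t K) + measure lborel (sliver \<eta> \<kappa>' t K)
        = 2 * measure lborel (sliver \<eta> (\<kappa>' + axis i t) t K)"
      using insert.prems by (intro insert.IH) auto
    have 2: "measure lborel (sliver \<eta> ((\<kappa>' + axis k t) + axis i (2 * t)) t K)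
          + measure lborel (sliver \<eta> (\<kappa>' + axis k t) t K)
        = 2 * measure lborel (sliver \<eta> ((\<kappa>' + axis k t) + axis i t) t K)"
    proof (rule insert.IH [OF \<open>i \<notin> K\<close>])
      fix m
      show "\<kappa> $ m \<le> (\<kappa>' + axis k t) $ m" "(\<kappa>' + axis k t) $ m \<le> \<kappa> $ m + t"
        using insert.prems(2) [of m] insert.prems(3) [of m] insert.prems(4) [of m] \<open>0 \<le> t\<close>
        by (auto simp: axis_nth_if)
      show "(\<kappa>' + axis k t) $ m = \<kappa> $ m" if "m \<in> K"
        using insert.prems(4) [of m] that \<open>k \<notin> K\<close> by (auto simp: axis_nth_if)
    qed
    have swap: "\<kappa>' + axis i c + axis k t = (\<kappa>' + axis k t) + axis i c" for c
      by (simp add: algebra_simps)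
    show ?case
      unfolding measure_sliver_insert [OF bdd \<open>0 \<le> t\<close> \<open>k \<notin> K\<close>] swap using 1 2 by simp
  qed
qed

lemma measure_adjacent_slivers:
  fixes \<eta> :: "'n::finite \<Rightarrow> 'a::euclidean_space"
  assumes bdd: "\<And>\<kappa>'. bounded (halfspace_Int \<eta> \<kappa>')" and t: "0 \<le> t" and i: "i \<in> L"
    and sd: "\<And>\<kappa>'. \<lbrakk>\<And>m. \<kappa> $ m \<le> \<kappa>' $ m; \<And>m. \<kappa>' $ m \<le> \<kappa> $ m + t\<rbrakk> \<Longrightarrow>
      measure lborel (halfspace_Int \<eta> (\<kappa>' + axis i (2 * t))) + measure lborel (halfspace_Int \<eta> \<kappa>')
        = 2 * measure lborel (halfspace_Int \<eta> (\<kappa>' + axis i t))"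
  shows "measure lborel (sliver \<eta> (\<kappa> + axis i t) t L) = measure lborel (sliver \<eta> \<kappa> t L)"
proof -
  have double: "\<kappa> + axis i (2 * t) = \<kappa> + axis i t + axis i t"
    by (simp add: vec_eq_iff axis_nth_if)
  have "measure lborel (sliver \<eta> (\<kappa> + axis i t) t (insert i (L - {i})))
      = measure lborel (sliver \<eta> (\<kappa> + axis i (2 * t)) t (L - {i}))
        - measure lborel (sliver \<eta> (\<kappa> + axis i t) t (L - {i}))"
    unfolding double by (rule measure_sliver_insert [OF bdd t]) simp
  moreover have "measure lborel (sliver \<eta> \<kappa> t (insert i (L - {i})))
      = measure lborel (sliver \<eta> (\<kappa> + axis i t) t (L - {i}))
        - measure lborel (sliver \<eta> \<kappa> t (L - {i}))"
    by (rule measure_sliver_insert [OF bdd t]) simp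
  moreover have "measure lborel (sliver \<eta> (\<kappa> + axis i (2 * t)) t (L - {i}))
        + measure lborel (sliver \<eta> \<kappa> t (L - {i}))
      = 2 * measure lborel (sliver \<eta> (\<kappa> + axis i t) t (L - {i}))"
    by (rule second_difference_sliver [OF bdd t _ sd]) (use t in auto)
  ultimately show ?thesis using i by (simp add: insert_absorb)
qed

section \<open>Flat facets\<close>

text \<open>The volume is affine in the \<open>i\<close>-th support number near \<open>\<kappa>\<close>, expressed by second
  differences with a step \<open>t\<close> below \<open>t0\<close>, which also bounds the changes of all support
  numbers.\<close>

definition volume_affine_in ::
  "('n::finite \<Rightarrow> 'a::euclidean_space) \<Rightarrow> real ^ 'n \<Rightarrow> 'n \<Rightarrow> real \<Rightarrow> bool" where
  "volume_affine_in \<eta> \<kappa> i t0 \<longleftrightarrow>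
     (\<forall>t \<kappa>'. 0 < t \<and> t < t0 \<and> (\<forall>m. \<kappa> $ m \<le> \<kappa>' $ m \<and> \<kappa>' $ m \<le> \<kappa> $ m + t) \<longrightarrow>
        measure lborel (halfspace_Int \<eta> (\<kappa>' + axis i (2 * t)))
          + measure lborel (halfspace_Int \<eta> \<kappa>')
        = 2 * measure lborel (halfspace_Int \<eta> (\<kappa>' + axis i t)))"

lemma open_Collect_ball_finite:
  fixes P :: "'n::finite \<Rightarrow> 'a::topological_space \<Rightarrow> bool"
  assumes "\<And>k. k \<in> K \<Longrightarrow> open {x. P k x}"
  shows "open {x. \<forall>k\<in>K. P k x}"
proof -
  have "{x. \<forall>k\<in>K. P k x} = (\<Inter>k\<in>K. {x. P k x})" by auto
  then show ?thesis using assms by (simp add: open_INT)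
qed

text \<open>Let \<open>w\<close> be tangent to all facets through the vertex \<open>v\<close> except the \<open>i\<close>-th. Then \<open>w\<close> is also
  tangent to the facet \<open>k'\<close> that is new at the other end of an edge of the \<open>i\<close>-th facet. Take the
  iterated difference of the volume in the directions of all facets containing the edge. It is the
  volume of a thin sliver along the edge, and is the same for the two consecutive slivers between the
  levels \<open>\<kappa> $ i\<close>, \<open>\<kappa> $ i + t\<close> and \<open>\<kappa> $ i + 2 * t\<close> of \<open>\<eta> i\<close>. Translation by \<open>t *\<^sub>R w\<close> takes the first to the
  second except for the position of the end at \<open>k'\<close>.\<close>

lemma volume_affine_edge:
  fixes \<eta> :: "'n::finite \<Rightarrow> 'a::euclidean_space"
  assumes sp: "simple_polytope \<eta> \<kappa>" and va: "volume_affine_in \<eta> \<kappa> i t0" "0 < t0"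
    and v: "v extreme_point_of halfspace_Int \<eta> \<kappa>"
    and i: "i \<in> active \<eta> \<kappa> v" and k: "k \<in> active \<eta> \<kappa> v" "k \<noteq> i"
    and w: "\<eta> i \<bullet> w = 1" "\<And>l. l \<in> active \<eta> \<kappa> v - {i} \<Longrightarrow> \<eta> l \<bullet> w = 0"
    and u: "\<And>l. l \<in> active \<eta> \<kappa> v - {k} \<Longrightarrow> \<eta> l \<bullet> u = 0" "\<eta> k \<bullet> u = - 1"
    and k': "k' \<notin> active \<eta> \<kappa> v" "0 < \<eta> k' \<bullet> u"
    and v': "(v + T *\<^sub>R u) extreme_point_of halfspace_Int \<eta> \<kappa>"
    and act: "active \<eta> \<kappa> (v + T *\<^sub>R u) = insert k' (active \<eta> \<kappa> v - {k})"
  shows "\<eta> k' \<bullet> w = 0"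
proof (rule ccontr)
  define c where "c = \<eta> k' \<bullet> w"
  assume "\<eta> k' \<bullet> w \<noteq> 0"
  then have "c \<noteq> 0" by (simp add: c_def)
  let ?B = "active \<eta> \<kappa> v"
  define L where "L = ?B - {k}"
  have iL: "i \<in> L" and kL: "k \<notin> L" and k'L: "k' \<notin> L" and kk': "k \<noteq> k'"
    using i k k'(1) by (auto simp: L_def)
  note bdd = simple_polytope_bounded_change [OF sp]
  note vertex' = simple_polytope_vertex [OF sp v']
  obtain \<epsilon> where \<epsilon>: "0 < \<epsilon>"
    "\<And>x. (\<And>k. \<eta> k \<bullet> x \<le> \<kappa> $ k + \<epsilon>) \<Longrightarrow>
      \<exists>y\<in>halfspace_Int \<eta> \<kappa>. {k. \<kappa> $ k - \<epsilon> \<le> \<eta> k \<bullet> x} \<subseteq> active \<eta> \<kappa> y"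
    using near_active_subset_active [OF bdd] by blast
  \<comment> \<open>With \<open>t \<le> \<epsilon> / C\<close> both the offsets, up to \<open>2 * t\<close>, and the translation change every inequality by
    at most \<open>\<epsilon>\<close>.\<close>
  define C where "C = 3 + (\<Sum>m\<in>UNIV. \<bar>\<eta> m \<bullet> w\<bar>)"
  have C: "3 \<le> C" "\<bar>\<eta> m \<bullet> w\<bar> \<le> C" for m
  proof -
    show "3 \<le> C" by (simp add: C_def sum_nonneg)
    have "\<bar>\<eta> m \<bullet> w\<bar> \<le> (\<Sum>m\<in>UNIV. \<bar>\<eta> m \<bullet> w\<bar>)" by (rule member_le_sum) auto
    then show "\<bar>\<eta> m \<bullet> w\<bar> \<le> C" by (simp add: C_def)
  qed
  define t where "t = min (t0 / 2) (\<epsilon> / C)"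
  have t: "0 < t" "t < t0" using va(2) \<epsilon>(1) C(1) by (auto simp: t_def)
  have "t * C \<le> \<epsilon>"
  proof -
    have "t \<le> \<epsilon> / C" by (simp add: t_def)
    then show ?thesis using C(1) by (simp add: pos_le_divide_eq)
  qed
  then have t3: "3 * t \<le> \<epsilon>" and tw: "t * \<bar>\<eta> m \<bullet> w\<bar> \<le> \<epsilon>" for m
    using mult_left_mono [OF C(1) less_imp_le [OF t(1)]]
      mult_left_mono [OF C(2) [of m] less_imp_le [OF t(1)]] by linarith+
  have tw': "- \<epsilon> \<le> t * (\<eta> m \<bullet> w)" "t * (\<eta> m \<bullet> w) \<le> \<epsilon>" for m
  proof -
    have "\<bar>t * (\<eta> m \<bullet> w)\<bar> \<le> \<epsilon>" using tw [of m] t(1) by (simp add: abs_mult)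
    then show "- \<epsilon> \<le> t * (\<eta> m \<bullet> w)" "t * (\<eta> m \<bullet> w) \<le> \<epsilon>" by (simp_all add: abs_le_iff)
  qed
  \<comment> \<open>Close to the edge, only the inequalities of its two end points matter.\<close>
  have near: "\<eta> m \<bullet> x < \<kappa> $ m - \<epsilon>"
    if x: "\<And>m. \<eta> m \<bullet> x \<le> \<kappa> $ m + \<epsilon>" "\<And>l. l \<in> L \<Longrightarrow> \<kappa> $ l - \<epsilon> \<le> \<eta> l \<bullet> x"
      and m: "m \<notin> insert k' ?B" for x m
  proof -
    obtain y where y: "y \<in> halfspace_Int \<eta> \<kappa>" "{m. \<kappa> $ m - \<epsilon> \<le> \<eta> m \<bullet> x} \<subseteq> active \<eta> \<kappa> y"
      using \<epsilon>(2) [OF x(1)] by blast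
    then have "?B - {k} \<subseteq> active \<eta> \<kappa> y" using x(2) by (auto simp: L_def)
    then have "active \<eta> \<kappa> y \<subseteq> insert k' ?B"
      using active_on_edge [OF sp v k(1) u k' act vertex'(1) y(1)] by blast
    then show ?thesis using y(2) m by force
  qed
  \<comment> \<open>The sliver, with the inequality \<open>k'\<close> replaced by the bound \<open>a\<close>.\<close>
  define E where "E a = {x. (\<forall>l\<in>L. \<kappa> $ l < \<eta> l \<bullet> x \<and> \<eta> l \<bullet> x \<le> \<kappa> $ l + t) \<and>
      (\<forall>m\<in>- insert k' L. \<eta> m \<bullet> x \<le> \<kappa> $ m) \<and> \<eta> k' \<bullet> x \<le> a}" for a
  have S1: "sliver \<eta> \<kappa> t L = E (\<kappa> $ k')"
    using k'L by (auto simp: sliver_def E_def)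
  have shift: "\<eta> m \<bullet> (x + t *\<^sub>R w) = \<eta> m \<bullet> x + t * (\<eta> m \<bullet> w)" for m x
    by (simp add: inner_right_distrib)
  have wL: "t * (\<eta> l \<bullet> w) = (if l = i then t else 0)" if "l \<in> L" for l
    using that w by (auto simp: L_def)
  have wk: "t * (\<eta> k \<bullet> w) = 0" using w(2) [of k] k by simp
  have S2: "{x. x + t *\<^sub>R w \<in> sliver \<eta> (\<kappa> + axis i t) t L} = E (\<kappa> $ k' - t * c)"
  proof (intro set_eqI iffI)
    fix x assume "x \<in> {x. x + t *\<^sub>R w \<in> sliver \<eta> (\<kappa> + axis i t) t L}"
    then have x: "if m \<in> L then (\<kappa> + axis i t) $ m < \<eta> m \<bullet> x + t * (\<eta> m \<bullet> w) \<and>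
        \<eta> m \<bullet> x + t * (\<eta> m \<bullet> w) \<le> (\<kappa> + axis i t) $ m + t
      else \<eta> m \<bullet> x + t * (\<eta> m \<bullet> w) \<le> (\<kappa> + axis i t) $ m" for m
      unfolding sliver_def mem_Collect_eq shift by blast
    have xL: "\<kappa> $ l < \<eta> l \<bullet> x" "\<eta> l \<bullet> x \<le> \<kappa> $ l + t" if "l \<in> L" for l
      using x [of l] that wL [OF that] by (auto simp: axis_nth_if split: if_splits)
    have xn: "\<eta> m \<bullet> x + t * (\<eta> m \<bullet> w) \<le> \<kappa> $ m" if "m \<notin> L" for m
    proof -
      have "m \<noteq> i" using that iL by blast
      then show ?thesis using x [of m] that by (simp add: axis_nth_if)
    qed
    have "\<eta> m \<bullet> x \<le> \<kappa> $ m" if m: "m \<in> - insert k' L" for m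
    proof (cases "m = k")
      case True
      then show ?thesis using xn [OF kL] wk by simp
    next
      case False
      have "\<eta> m \<bullet> (x + t *\<^sub>R w) < \<kappa> $ m - \<epsilon>"
      proof (rule near)
        show "\<eta> m \<bullet> (x + t *\<^sub>R w) \<le> \<kappa> $ m + \<epsilon>" for m
        proof (cases "m \<in> L")
          case True
          then show ?thesis using xL(2) [OF True] wL [OF True] t3 t(1) by (auto simp: shift)
        next
          case False
          then show ?thesis using xn [OF False] \<epsilon>(1) by (simp add: shift)
        qed
        show "\<kappa> $ l - \<epsilon> \<le> \<eta> l \<bullet> (x + t *\<^sub>R w)" if "l \<in> L" for l
          using xL(1) [OF that] wL [OF that] \<epsilon>(1) t(1) by (auto simp: shift)
        show "m \<notin> insert k' ?B" using m False by (auto simp: L_def)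
      qed
      then show ?thesis using tw'(1) [of m] by (simp add: shift)
    qed
    then show "x \<in> E (\<kappa> $ k' - t * c)"
      using xL xn [OF k'L] by (auto simp: E_def c_def)
  next
    fix x assume "x \<in> E (\<kappa> $ k' - t * c)"
    then have xL: "\<And>l. l \<in> L \<Longrightarrow> \<kappa> $ l < \<eta> l \<bullet> x" "\<And>l. l \<in> L \<Longrightarrow> \<eta> l \<bullet> x \<le> \<kappa> $ l + t"
      and xn: "\<And>m. m \<notin> L \<Longrightarrow> m \<noteq> k' \<Longrightarrow> \<eta> m \<bullet> x \<le> \<kappa> $ m"
      and xk': "\<eta> k' \<bullet> x + t * c \<le> \<kappa> $ k'"
      by (auto simp: E_def)
    have "\<eta> m \<bullet> x + t * (\<eta> m \<bullet> w) \<le> \<kappa> $ m" if m: "m \<notin> L" for m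
    proof -
      consider "m = k" | "m = k'" | "m \<notin> insert k' ?B" using m by (auto simp: L_def)
      then show ?thesis
      proof cases
        case 1
        then show ?thesis using xn [OF kL kk'] wk unfolding 1 by linarith
      next
        case 2
        then show ?thesis using xk' by (simp add: c_def)
      next
        case 3
        have "\<eta> m \<bullet> x < \<kappa> $ m - \<epsilon>"
        proof (rule near)
          show "\<eta> m \<bullet> x \<le> \<kappa> $ m + \<epsilon>" for m
          proof -
            consider "m \<in> L" | "m = k'" | "m \<notin> L" "m \<noteq> k'" by blast
            then show ?thesis
            proof cases
              case 1
              then show ?thesis using xL(2) [OF 1] t3 t(1) by linarith
            next
              case 2
              then show ?thesis using xk' tw'(1) [of k'] by (simp add: c_def)
            next
              case 3
              then show ?thesis using xn [OF 3] \<epsilon>(1) by linarith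
            qed
          qed
          show "\<kappa> $ l - \<epsilon> \<le> \<eta> l \<bullet> x" if "l \<in> L" for l
            using xL(1) [OF that] \<epsilon>(1) by linarith
        qed (rule 3)
        then show ?thesis using tw'(2) [of m] by linarith
      qed
    qed
    then show "x \<in> {x. x + t *\<^sub>R w \<in> sliver \<eta> (\<kappa> + axis i t) t L}"
      using xL wL iL unfolding sliver_def mem_Collect_eq shift by (auto simp: axis_nth_if)
  qed
  \<comment> \<open>The two slivers thus have the same volume, but after the translation they differ in a single
    inequality, by \<open>t * c\<close>.\<close>
  have eq: "measure lborel (E (\<kappa> $ k' - t * c)) = measure lborel (E (\<kappa> $ k'))"
  proof -
    have "measure lborel (sliver \<eta> (\<kappa> + axis i t) t L) = measure lborel (sliver \<eta> \<kappa> t L)"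
      using va(1) t unfolding volume_affine_in_def
      by (intro measure_adjacent_slivers [OF bdd _ iL]) auto
    then show ?thesis
      unfolding S1 [symmetric] S2 [symmetric] by (simp add: measure_lborel_translation)
  qed
  have less_measure: "measure lborel (E a) < measure lborel (E b)"
    if ab: "a < b" "{a, b} = {\<kappa> $ k', \<kappa> $ k' - t * c}" for a b
  proof (rule measure_lborel_strict_mono)
    have meas: "E d \<in> sets borel \<and> bounded (E d)" if "d \<in> {\<kappa> $ k', \<kappa> $ k' - t * c}" for d
    proof -
      have "{x. x + t *\<^sub>R w \<in> sliver \<eta> (\<kappa> + axis i t) t L}
          = (\<lambda>y. - (t *\<^sub>R w) + y) ` sliver \<eta> (\<kappa> + axis i t) t L"
        by (force simp: image_iff)
      then have "bounded (E (\<kappa> $ k' - t * c))"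
        using bounded_translation bounded_sliver [OF bdd, of t] t(1) unfolding S2 by (metis less_imp_le)
      moreover have "E (\<kappa> $ k' - t * c) \<in> sets borel"
        unfolding S2 [symmetric] by measurable
      moreover have "bounded (E (\<kappa> $ k'))" "E (\<kappa> $ k') \<in> sets borel"
        unfolding S1 [symmetric] using bounded_sliver [OF bdd, of t] t(1) by auto
      ultimately show ?thesis using that by auto
    qed
    show "E a \<in> sets borel" "E b \<in> sets borel" "bounded (E b)" using meas ab(2) by blast+
    show "E a \<subseteq> E b" using ab(1) by (auto simp: E_def)
    let ?U = "{x. \<forall>l\<in>L. \<kappa> $ l < \<eta> l \<bullet> x \<and> \<eta> l \<bullet> x < \<kappa> $ l + t} \<inter>
      {x. \<forall>m\<in>- insert k' L. \<eta> m \<bullet> x < \<kappa> $ m} \<inter> {x. a < \<eta> k' \<bullet> x \<and> \<eta> k' \<bullet> x < b}"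
    show "open ?U"
      by (intro open_Int open_Collect_ball_finite open_Collect_conj open_Collect_less
          continuous_intros)
    show "?U \<subseteq> E b - E a"
      unfolding E_def by (fastforce intro: less_imp_le)
    \<comment> \<open>A point of this set is found next to the end of the edge at \<open>k'\<close>, on the side of its
      hyperplane on which the two slivers differ.\<close>
    define d where "d = min t (b - a)"
    have "0 < d" using t(1) ab(1) by (simp add: d_def)
    define g where "g l = (if l = k' then (if b = \<kappa> $ k' then - 1 else 1) else 1 :: real)" for l
    obtain e x where e: "0 < e" "e < d"
      and x: "\<And>l. l \<in> active \<eta> \<kappa> (v + T *\<^sub>R u) \<Longrightarrow> \<eta> l \<bullet> x = \<kappa> $ l + e * g l"
        "\<And>l. l \<notin> active \<eta> \<kappa> (v + T *\<^sub>R u) \<Longrightarrow> \<eta> l \<bullet> x < \<kappa> $ l"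
      using perturb_vertex [OF vertex'(1,4,5) \<open>0 < d\<close>, of g] by blast
    have "x \<in> ?U"
    proof (intro IntI CollectI ballI)
      show "\<kappa> $ l < \<eta> l \<bullet> x \<and> \<eta> l \<bullet> x < \<kappa> $ l + t" if "l \<in> L" for l
        using x(1) [of l] that k'L e unfolding act L_def [symmetric] g_def d_def by auto
      show "\<eta> m \<bullet> x < \<kappa> $ m" if "m \<in> - insert k' L" for m
        using x(2) [of m] that unfolding act L_def by auto
      have "a = \<kappa> $ k' \<or> b = \<kappa> $ k'" using ab(2) by (auto simp: doubleton_eq_iff)
      then show "a < \<eta> k' \<bullet> x \<and> \<eta> k' \<bullet> x < b"
        using x(1) [of k'] e ab(1) unfolding act g_def d_def by auto
    qed
    then show "?U \<noteq> {}" by blast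
  qed
  have "t * c \<noteq> 0" using \<open>c \<noteq> 0\<close> t(1) by simp
  then show False
  proof (cases "t * c" "0 :: real" rule: linorder_cases)
    case less
    then show False using less_measure [of "\<kappa> $ k'" "\<kappa> $ k' - t * c"] eq by simp
  next
    case greater
    then show False
      using less_measure [of "\<kappa> $ k' - t * c" "\<kappa> $ k'"] eq by (simp add: insert_commute)
  qed simp
qed

text \<open>The direction \<open>w\<close> dual to \<open>\<eta> i\<close> at one vertex of the \<open>i\<close>-th facet is, by the previous lemma,
  also dual to it at the adjacent vertices in the facet, and so at all its vertices.\<close>

lemma flat_facet_if_volume_affine:
  fixes \<eta> :: "'n::finite \<Rightarrow> 'a::euclidean_space"
  assumes sp: "simple_polytope \<eta> \<kappa>" and va: "volume_affine_in \<eta> \<kappa> i t0" "0 < t0"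
  shows "flat_facet \<eta> \<kappa> i"
proof -
  note vertex = simple_polytope_vertex [OF sp]
  obtain v0 where v0: "v0 extreme_point_of halfspace_Int \<eta> \<kappa>" "i \<in> active \<eta> \<kappa> v0"
    using simple_polytope_facet_vertex [OF sp] by blast
  obtain w where w': "\<And>l. l \<in> active \<eta> \<kappa> v0 \<Longrightarrow> \<eta> l \<bullet> w = (if l = i then 1 else 0)"
    using independent_family_dual [OF vertex(4,5) [OF v0(1)], of "\<lambda>l. if l = i then 1 else 0"]
    by blast
  then have w: "\<eta> i \<bullet> w = 1" using v0(2) by simp
  define G where "G = {v. v extreme_point_of halfspace_Int \<eta> \<kappa> \<and> i \<in> active \<eta> \<kappa> v \<and>
      (\<forall>l\<in>active \<eta> \<kappa> v - {i}. \<eta> l \<bullet> w = 0)}"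
  have "v0 \<in> G" using v0 w' by (simp add: G_def)
  have "finite G"
    by (rule finite_subset [OF _ finite_polyhedron_extreme_points [OF polyhedron_halfspace_Int]])
      (auto simp: G_def)
  \<comment> \<open>A vertex of the facet outside \<open>G\<close> would be the unique maximum of a linear functional; but a
    maximum over \<open>G\<close> is a local maximum along the edges of the facet, hence a global one.\<close>
  have all_G: "v1 \<in> G" if v1: "v1 extreme_point_of halfspace_Int \<eta> \<kappa>" "i \<in> active \<eta> \<kappa> v1" for v1
  proof -
    define c where "c = (\<Sum>l\<in>active \<eta> \<kappa> v1. \<eta> l)"
    obtain v where v: "v \<in> G" and v_max: "\<And>v'. v' \<in> G \<Longrightarrow> c \<bullet> v' \<le> c \<bullet> v"
      using ex_is_arg_min_if_finite [OF \<open>finite G\<close>, of "\<lambda>v. - (c \<bullet> v)"] \<open>v0 \<in> G\<close>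
      by (auto simp: is_arg_min_def not_less)
    let ?B = "active \<eta> \<kappa> v"
    have ext: "v extreme_point_of halfspace_Int \<eta> \<kappa>" and iB: "i \<in> ?B"
      and wB: "\<And>l. l \<in> ?B - {i} \<Longrightarrow> \<eta> l \<bullet> w = 0" using v by (auto simp: G_def)
    have "\<exists>u. \<forall>l\<in>?B. \<eta> l \<bullet> u = (if l = k then - 1 else 0)" for k
      by (rule independent_family_dual [OF vertex(4,5) [OF ext],
            of "\<lambda>l. if l = k then - 1 else 0"]) blast
    then have "\<exists>u. \<forall>k. \<forall>l\<in>?B. \<eta> l \<bullet> u k = (if l = k then - 1 else 0)"
      by (intro choice allI)
    then obtain u where u: "\<And>k l. l \<in> ?B \<Longrightarrow> \<eta> l \<bullet> u k = (if l = k then - 1 else 0)" by blast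
    have cu: "c \<bullet> u k \<le> 0" if k: "k \<in> ?B - {i}" for k
    proof -
      have uk: "\<And>l. l \<in> ?B - {k} \<Longrightarrow> \<eta> l \<bullet> u k = 0" "\<eta> k \<bullet> u k = - 1" using u k by auto
      obtain T k' where T: "0 < T" "k' \<notin> ?B" "0 < \<eta> k' \<bullet> u k"
        "(v + T *\<^sub>R u k) extreme_point_of halfspace_Int \<eta> \<kappa>"
        "active \<eta> \<kappa> (v + T *\<^sub>R u k) = insert k' (?B - {k})"
        using simple_polytope_edge [OF sp ext _ uk] k by blast
      have "\<eta> k' \<bullet> w = 0"
        using volume_affine_edge [OF sp va ext iB _ _ w wB uk T(2,3,4,5)] k by blast
      then have "v + T *\<^sub>R u k \<in> G" using T(4,5) iB k wB by (auto simp: G_def)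
      from v_max [OF this] show ?thesis
        using T(1) by (simp add: inner_right_distrib mult_le_0_iff)
    qed
    have "v1 = v + (\<Sum>k\<in>?B - {i}. (\<kappa> $ k - \<eta> k \<bullet> v1) *\<^sub>R u k)"
    proof (rule spanning_family_eqI [OF vertex(3) [OF ext]])
      fix l assume l: "l \<in> ?B"
      have "\<eta> l \<bullet> (\<Sum>k\<in>?B - {i}. (\<kappa> $ k - \<eta> k \<bullet> v1) *\<^sub>R u k)
          = (\<Sum>k\<in>?B - {i}. if k = l then \<eta> l \<bullet> v1 - \<kappa> $ l else 0)"
        unfolding inner_sum_right by (rule sum.cong) (auto simp: u [OF l])
      also have "\<dots> = \<eta> l \<bullet> v1 - \<kappa> $ l"
        using l v1(2) by (auto simp: active_def)
      finally show "\<eta> l \<bullet> v1 = \<eta> l \<bullet> (v + (\<Sum>k\<in>?B - {i}. (\<kappa> $ k - \<eta> k \<bullet> v1) *\<^sub>R u k))"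
        using l by (simp add: inner_right_distrib active_def)
    qed
    then have "c \<bullet> v1 = c \<bullet> v + (\<Sum>k\<in>?B - {i}. (\<kappa> $ k - \<eta> k \<bullet> v1) * (c \<bullet> u k))"
      by (metis (no_types, lifting) inner_right_distrib inner_scaleR_right inner_sum_right sum.cong)
    moreover have "(\<Sum>k\<in>?B - {i}. (\<kappa> $ k - \<eta> k \<bullet> v1) * (c \<bullet> u k)) \<le> 0"
      using cu vertex(1) [OF v1(1)]
      by (intro sum_nonpos mult_nonneg_nonpos) (auto simp: mem_halfspace_Int)
    ultimately have "c \<bullet> v1 \<le> c \<bullet> v" by simp
    moreover have "c \<bullet> v1 = (\<Sum>l\<in>active \<eta> \<kappa> v1. \<kappa> $ l)"
      using sum_active_bound(2) [OF vertex(1) [OF v1(1)]] by (auto simp: c_def)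
    ultimately have "active \<eta> \<kappa> v1 \<subseteq> ?B"
      using sum_active_bound [OF vertex(1) [OF ext], of "active \<eta> \<kappa> v1"] by (simp add: c_def)
    then have "v1 = v"
      by (intro spanning_family_eqI [OF vertex(3) [OF v1(1)]]) (auto simp: active_def)
    then show ?thesis using v by simp
  qed
  let ?V = "{y. w \<bullet> y = 0}"
  have "w \<noteq> 0" using w by auto
  then have "subspace ?V" "dim ?V + 1 = DIM('a)"
    by (simp_all add: subspace_hyperplane dim_hyperplane)
  moreover have "\<eta> j \<in> ?V" if j: "j \<noteq> i \<and> facet \<eta> \<kappa> i \<inter> facet \<eta> \<kappa> j \<noteq> {}" for j
  proof -
    obtain y where y: "y \<in> halfspace_Int \<eta> \<kappa>" "{i, j} \<subseteq> active \<eta> \<kappa> y"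
      using j by (auto simp: facet_def active_def)
    obtain v where v: "v extreme_point_of halfspace_Int \<eta> \<kappa>" "active \<eta> \<kappa> y \<subseteq> active \<eta> \<kappa> v"
      using active_subset_active_vertex [OF simple_polytope_bounded [OF sp] y(1)] by blast
    then have "v \<in> G" using all_G y(2) by blast
    then show ?thesis using v(2) y(2) j by (auto simp: G_def inner_commute)
  qed
  ultimately show ?thesis unfolding flat_facet_def by blast
qed

section \<open>Mass linear functions\<close>

lemma center_of_mass_linear:
  fixes f :: "'a::euclidean_space \<Rightarrow> real"
  assumes "linear f" "measure lborel S \<noteq> 0" "f (center_of_mass S) = y"
  shows "f (LINT x:S|lborel. x) = y * measure lborel S"
proof -
  have "y = inverse (measure lborel S) * f (LINT x:S|lborel. x)"
    using assms(3) by (simp add: center_of_mass_def linear_cmul [OF assms(1)])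
  then show ?thesis using assms(2) by (simp add: field_simps)
qed

lemma measure_simple_polytope_pos:
  fixes \<eta> :: "'n::finite \<Rightarrow> 'a::euclidean_space"
  assumes sp: "simple_polytope \<eta> \<kappa>"
  shows "0 < measure lborel (halfspace_Int \<eta> \<kappa>)"
proof -
  obtain p where p: "\<And>k. \<eta> k \<bullet> p < \<kappa> $ k" using simple_polytope_interior_point [OF sp] by blast
  let ?U = "{x. \<forall>k\<in>UNIV. \<eta> k \<bullet> x < \<kappa> $ k}"
  have "measure lborel ({} :: 'a set) < measure lborel (halfspace_Int \<eta> \<kappa>)"
  proof (rule measure_lborel_strict_mono)
    show "halfspace_Int \<eta> \<kappa> \<in> sets borel" by (simp add: borel_closed closed_halfspace_Int)
    show "bounded (halfspace_Int \<eta> \<kappa>)" by (rule simple_polytope_bounded [OF sp])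
    show "open ?U" by (rule open_strict_halfspaces)
    show "?U \<noteq> {}" using p by auto
    show "?U \<subseteq> halfspace_Int \<eta> \<kappa> - {}" by (auto simp: mem_halfspace_Int less_imp_le)
  qed auto
  then show ?thesis by simp
qed

lemma center_of_mass_translation:
  fixes S :: "'a::euclidean_space set"
  assumes "compact S" "measure lborel S \<noteq> 0"
  shows "center_of_mass {x. x - \<xi> \<in> S} = center_of_mass S + \<xi>"
proof -
  have meas: "S \<in> sets borel" using assms(1) by (simp add: borel_compact)
  have meas': "{x. x - \<xi> \<in> S} \<in> sets borel" using meas by measurable
  have int: "integrable lborel (\<lambda>x. indicator S x *\<^sub>R x)"
    and int1: "integrable lborel (\<lambda>x. indicator S x *\<^sub>R \<xi>)"
    using assms(1) by (intro borel_integrable_compact continuous_intros; simp)+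
  have "measure lborel {x. x - \<xi> \<in> S} = measure lborel S"
    using measure_lborel_translation [OF meas, of "- \<xi>"] by simp
  moreover have "(LINT x:{x. x - \<xi> \<in> S}|lborel. x) = (LINT x:S|lborel. x) + measure lborel S *\<^sub>R \<xi>"
  proof -
    have "(LINT x:{x. x - \<xi> \<in> S}|lborel. x)
        = (\<integral>x. indicator {x. x - \<xi> \<in> S} x *\<^sub>R x \<partial>distr lborel borel ((+) \<xi>))"
      by (simp add: set_lebesgue_integral_def lborel_distr_plus)
    also have "\<dots> = (\<integral>x. indicator {x. x - \<xi> \<in> S} (\<xi> + x) *\<^sub>R (\<xi> + x) \<partial>lborel)"
      using meas' by (intro integral_distr) auto
    also have "\<dots> = (\<integral>x. indicator S x *\<^sub>R x + indicator S x *\<^sub>R \<xi> \<partial>lborel)"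
      by (rule Bochner_Integration.integral_cong) (auto simp: indicator_def)
    also have "\<dots> = (\<integral>x. indicator S x *\<^sub>R x \<partial>lborel) + (\<integral>x. indicator S x *\<^sub>R \<xi> \<partial>lborel)"
      by (rule Bochner_Integration.integral_add [OF int int1])
    also have "(\<integral>x. indicator S x *\<^sub>R \<xi> \<partial>lborel) = measure lborel S *\<^sub>R \<xi>"
      using meas emeasure_bounded_finite [OF compact_imp_bounded [OF assms(1)]] by simp
    finally show ?thesis by (simp add: set_lebesgue_integral_def)
  qed
  ultimately show ?thesis
    using assms(2) by (simp add: center_of_mass_def scaleR_add_right)
qed

text \<open>If the coefficient of the \<open>i\<close>-th facet is nonzero, then the volume is affine in the support
  number of every facet \<open>j\<close> disjoint from it. Write \<open>V s r\<close> for the volume after moving the two facets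
  by \<open>s\<close> and \<open>r\<close>. Then the integral of the linear part \<open>f\<close> of \<open>H\<close> is
  \<open>(L + \<gamma> i * s + \<gamma> j * r) * V s r\<close>, and as the mixed differences of the volume and of this
  integral vanish,
  \<open>\<gamma> j * r * (V s 0 - V 0 0) + \<gamma> i * s * (V 0 r - V 0 0) = 0\<close>. For fixed \<open>s\<close>, the quotient
  \<open>(V 0 r - V 0 0) / r\<close> is therefore independent of \<open>r\<close>.\<close>

lemma volume_affine_if_mass_linear:
  fixes \<eta> :: "'n::finite \<Rightarrow> 'a::euclidean_space"
  assumes sp: "simple_polytope \<eta> \<kappa>"
    and f: "linear f" and H: "\<And>x. H x = f x + c0"
    and ml: "\<And>\<kappa>'. \<kappa>' \<in> chamber \<eta> \<kappa> \<Longrightarrow>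
      H (center_of_mass (halfspace_Int \<eta> \<kappa>')) = (\<Sum>m\<in>UNIV. \<gamma> m * \<kappa>' $ m) + C"
    and ij: "i \<noteq> j" "facet \<eta> \<kappa> i \<inter> facet \<eta> \<kappa> j = {}" and \<gamma>: "\<gamma> i \<noteq> 0"
  obtains t0 where "0 < t0" "volume_affine_in \<eta> \<kappa> j t0"
proof -
  note bdd = simple_polytope_bounded_change [OF sp]
  obtain \<epsilon>1 where \<epsilon>1: "0 < \<epsilon>1" "\<And>\<kappa>'. (\<And>m. \<bar>\<kappa>' $ m - \<kappa> $ m\<bar> \<le> \<epsilon>1) \<Longrightarrow> \<kappa>' \<in> chamber \<eta> \<kappa>"
    "\<And>\<kappa>'. (\<And>m. \<bar>\<kappa>' $ m - \<kappa> $ m\<bar> \<le> \<epsilon>1) \<Longrightarrow> simple_polytope \<eta> \<kappa>'"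
    using chamber_contains_box [OF sp] by blast
  obtain \<epsilon>2 where \<epsilon>2: "0 < \<epsilon>2"
    "\<And>x. (\<And>k. \<eta> k \<bullet> x \<le> \<kappa> $ k + \<epsilon>2) \<Longrightarrow>
      \<exists>y\<in>halfspace_Int \<eta> \<kappa>. {k. \<kappa> $ k - \<epsilon>2 \<le> \<eta> k \<bullet> x} \<subseteq> active \<eta> \<kappa> y"
    using near_active_subset_active [OF bdd] by blast
  define t0 where "t0 = min \<epsilon>1 \<epsilon>2 / 3"
  have "volume_affine_in \<eta> \<kappa> j t0"
    unfolding volume_affine_in_def
  proof (intro allI impI, elim conjE)
    fix t \<kappa>' assume t: "0 < t" "t < t0" and \<kappa>': "\<forall>m. \<kappa> $ m \<le> \<kappa>' $ m \<and> \<kappa>' $ m \<le> \<kappa> $ m + t"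
    have t3: "3 * t \<le> \<epsilon>1" "3 * t \<le> \<epsilon>2" using t(2) by (auto simp: t0_def)
    define L where "L = (\<Sum>m\<in>UNIV. \<gamma> m * \<kappa>' $ m) + C - c0"
    define P where "P s r = halfspace_Int \<eta> (\<kappa>' + axis i s + axis j r)" for s r
    define V where "V s r = measure lborel (P s r)" for s r
    define Y where "Y s r = f (LINT x:P s r|lborel. x)" for s r
    have near: "\<bar>(\<kappa>' + axis i s + axis j r) $ m - \<kappa> $ m\<bar> \<le> 3 * t"
      if "0 \<le> s" "s \<le> t" "0 \<le> r" "r \<le> 2 * t" for s r m
      using \<kappa>' [rule_format, of m] that ij(1) by (auto simp: axis_nth_if)
    have Y: "Y s r = (L + \<gamma> i * s + \<gamma> j * r) * V s r"
      if sr: "0 \<le> s" "s \<le> t" "0 \<le> r" "r \<le> 2 * t" for s r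
    proof -
      let ?\<kappa> = "\<kappa>' + axis i s + axis j r"
      have near1: "\<bar>?\<kappa> $ m - \<kappa> $ m\<bar> \<le> \<epsilon>1" for m using near [OF sr, of m] t3 by linarith
      have axis_sum: "(\<Sum>m\<in>UNIV. \<gamma> m * axis l a $ m) = \<gamma> l * a" for l a
        by (simp add: axis_nth_if if_distrib cong: if_cong)
      have "(\<Sum>m\<in>UNIV. \<gamma> m * ?\<kappa> $ m) = (\<Sum>m\<in>UNIV. \<gamma> m * \<kappa>' $ m) + \<gamma> i * s + \<gamma> j * r"
        by (simp add: distrib_left sum.distrib axis_sum)
      then have "f (center_of_mass (P s r)) = L + \<gamma> i * s + \<gamma> j * r"
        using ml [OF \<epsilon>1(2) [OF near1]] H [of "center_of_mass (P s r)"] by (simp add: L_def P_def)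
      moreover have "measure lborel (P s r) \<noteq> 0"
        using measure_simple_polytope_pos [OF \<epsilon>1(3) [OF near1]] by (simp add: P_def)
      ultimately show ?thesis
        unfolding Y_def V_def by (intro center_of_mass_linear [OF f])
    qed
    have diff: "\<gamma> j * r * (V t 0 - V 0 0) + \<gamma> i * t * (V 0 r - V 0 0) = 0"
      if r: "0 \<le> r" "r \<le> 2 * t" for r
    proof -
      have disj: "\<eta> i \<bullet> x < \<kappa>' $ i \<or> \<eta> j \<bullet> x < \<kappa>' $ j"
        if x: "x \<in> halfspace_Int \<eta> (\<kappa>' + axis i t + axis j r)" for x
      proof (rule ccontr)
        assume neg: "\<not> ?thesis"
        have "\<eta> m \<bullet> x \<le> \<kappa> $ m + \<epsilon>2" for m
        proof -
          have "\<eta> m \<bullet> x \<le> (\<kappa>' + axis i t + axis j r) $ m" using x by (simp only: mem_halfspace_Int)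
          also have "\<dots> \<le> \<kappa> $ m + \<epsilon>2" using near [of t r m] t(1) r t3(2) by linarith
          finally show ?thesis .
        qed
        then obtain y where y: "y \<in> halfspace_Int \<eta> \<kappa>" "{k. \<kappa> $ k - \<epsilon>2 \<le> \<eta> k \<bullet> x} \<subseteq> active \<eta> \<kappa> y"
          using \<epsilon>2(2) by blast
        have "\<kappa> $ i - \<epsilon>2 \<le> \<eta> i \<bullet> x" "\<kappa> $ j - \<epsilon>2 \<le> \<eta> j \<bullet> x"
          using neg \<kappa>' [rule_format, of i] \<kappa>' [rule_format, of j] \<epsilon>2(1) by linarith+
        then have "i \<in> active \<eta> \<kappa> y" "j \<in> active \<eta> \<kappa> y" using y(2) by auto
        then have "y \<in> facet \<eta> \<kappa> i \<inter> facet \<eta> \<kappa> j" using y(1) by (auto simp: facet_def active_def)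
        then show False using ij(2) by blast
      qed
      have mixed: "(LINT x:P t r|lborel. g x) + (LINT x:P 0 0|lborel. g x)
          = (LINT x:P t 0|lborel. g x) + (LINT x:P 0 r|lborel. g x)"
        if "continuous_on UNIV g" for g :: "'a \<Rightarrow> 'b::{banach, second_countable_topology}"
        using mixed_difference_zero [OF bdd that ij(1) less_imp_le [OF t(1)] r(1) disj]
        by (simp add: P_def axis_eq_0_iff [THEN iffD2])
      have "V t r + V 0 0 = V t 0 + V 0 r"
      proof -
        have "P s r \<in> sets lborel" for s r by (simp add: P_def borel_closed closed_halfspace_Int)
        then show ?thesis
          using mixed [of "\<lambda>_. 1 :: real"] unfolding V_def by (simp only: measure_eq_set_integral continuous_on_const)
      qed
      then have Vtr: "V t r = V t 0 + V 0 r - V 0 0" by simp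
      have "Y t r + Y 0 0 = Y t 0 + Y 0 r"
        using mixed [OF continuous_on_id] unfolding Y_def linear_add [OF f, symmetric] by simp
      then have "(L + \<gamma> i * t + \<gamma> j * r) * V t r + L * V 0 0
          = (L + \<gamma> i * t) * V t 0 + (L + \<gamma> j * r) * V 0 r"
        using Y [of t r] Y [of 0 0] Y [of t 0] Y [of 0 r] t(1) r by simp
      then show ?thesis unfolding Vtr by (simp add: algebra_simps)
    qed
    have "\<gamma> i * t * (V 0 (2 * t) - V 0 0) = \<gamma> i * t * (2 * (V 0 t - V 0 0))"
      using diff [of t] diff [of "2 * t"] t(1) by (simp add: algebra_simps)
    then have "V 0 (2 * t) + V 0 0 = 2 * V 0 t" using \<gamma> t(1) by simp
    then show "measure lborel (halfspace_Int \<eta> (\<kappa>' + axis j (2 * t)))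
        + measure lborel (halfspace_Int \<eta> \<kappa>')
      = 2 * measure lborel (halfspace_Int \<eta> (\<kappa>' + axis j t))"
      by (simp add: V_def P_def axis_eq_0_iff [THEN iffD2])
  qed
  moreover have "0 < t0" using \<epsilon>1(1) \<epsilon>2(1) by (simp add: t0_def)
  ultimately show thesis using that by blast
qed

theorem theorem1p11:
  fixes \<eta> :: "'n::finite \<Rightarrow> 'a::euclidean_space"
    and \<kappa> :: "real ^ 'n"
    and H :: "'a \<Rightarrow> real"
  assumes "simple_polytope \<eta> \<kappa>"
    and "\<And>i. \<not> pervasive_facet \<eta> \<kappa> i"
    and "\<And>i. \<not> flat_facet \<eta> \<kappa> i"
    and "mass_linear \<eta> \<kappa> H"
  shows "H constant_on UNIV"
proof -
  note sp = assms(1)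
  obtain f c0 where f: "linear f" and H: "\<And>x. H x = f x + c0"
    using assms(4) unfolding mass_linear_def affine_function_def by blast
  obtain \<gamma> C where "\<forall>\<kappa>' \<in> chamber \<eta> \<kappa>.
      H (center_of_mass (halfspace_Int \<eta> \<kappa>')) = (\<Sum>m\<in>UNIV. \<gamma> m * \<kappa>' $ m) + C"
    using assms(4) unfolding mass_linear_def by (elim conjE exE that)
  note ml = this [rule_format]
  have \<gamma>0: "\<gamma> i = 0" for i
  proof (rule ccontr)
    assume "\<gamma> i \<noteq> 0"
    obtain j where j: "i \<noteq> j" "facet \<eta> \<kappa> i \<inter> facet \<eta> \<kappa> j = {}"
      using assms(2) [of i] unfolding pervasive_facet_def by metis
    obtain t0 where "0 < t0" "volume_affine_in \<eta> \<kappa> j t0"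
      by (rule volume_affine_if_mass_linear [OF sp f H ml j \<open>\<gamma> i \<noteq> 0\<close>])
    then show False using flat_facet_if_volume_affine [OF sp] assms(3) by blast
  qed
  \<comment> \<open>So \<open>H\<close> is constant on the centers of mass, in particular on those of small translates.\<close>
  obtain \<epsilon> where \<epsilon>: "0 < \<epsilon>" "\<And>\<kappa>'. (\<And>m. \<bar>\<kappa>' $ m - \<kappa> $ m\<bar> \<le> \<epsilon>) \<Longrightarrow> \<kappa>' \<in> chamber \<eta> \<kappa>"
    using chamber_contains_box [OF sp] by blast
  have "f \<xi> = 0" for \<xi>
  proof -
    obtain e where e: "0 < e" "\<And>m. e * \<bar>\<eta> m \<bullet> \<xi>\<bar> < \<epsilon>"
      using small_multiple [of UNIV "\<lambda>_. \<epsilon>" "\<lambda>m. \<bar>\<eta> m \<bullet> \<xi>\<bar>"] \<epsilon>(1) by auto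
    define \<kappa>' where "\<kappa>' = (\<chi> m. \<kappa> $ m + \<eta> m \<bullet> (e *\<^sub>R \<xi>))"
    have "\<bar>\<kappa>' $ m - \<kappa> $ m\<bar> \<le> \<epsilon>" for m
      using e(2) [of m] e(1) by (simp add: \<kappa>'_def abs_mult)
    then have "\<kappa>' \<in> chamber \<eta> \<kappa>" by (rule \<epsilon>(2))
    moreover have "\<kappa> \<in> chamber \<eta> \<kappa>" using \<epsilon> by simp
    ultimately have "H (center_of_mass (halfspace_Int \<eta> \<kappa>')) = H (center_of_mass (halfspace_Int \<eta> \<kappa>))"
      using ml \<gamma>0 by simp
    moreover have "halfspace_Int \<eta> \<kappa>' = {x. x - e *\<^sub>R \<xi> \<in> halfspace_Int \<eta> \<kappa>}"
      by (auto simp: mem_halfspace_Int \<kappa>'_def inner_diff_right algebra_simps)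
    moreover have "compact (halfspace_Int \<eta> \<kappa>)"
      using simple_polytope_bounded [OF sp] by (simp add: compact_eq_bounded_closed closed_halfspace_Int)
    ultimately have "f (center_of_mass (halfspace_Int \<eta> \<kappa>) + e *\<^sub>R \<xi>)
        = f (center_of_mass (halfspace_Int \<eta> \<kappa>))"
      using center_of_mass_translation [of "halfspace_Int \<eta> \<kappa>" "e *\<^sub>R \<xi>"]
        measure_simple_polytope_pos [OF sp] H by simp
    then show ?thesis using e(1) by (simp add: linear_add [OF f] linear_cmul [OF f])
  qed
  then show ?thesis by (simp add: constant_on_def H)
qed

end
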